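(* Let $K\ge 2$, $n\ge 1$, $L\ge 1$ and $d\ge K$ be integers. Consider the optimization problem $$(\mathrm{P})\qquad \min_{W_L,\dots,W_1,H_1}\ \|H_1\|_F^2+\sum_{l=1}^L\|W_l\|_F^2\quad\text{s.t.}\quad (z_{ic})_c-(z_{ic})_{c'}\ge 1\ \text{ for all } c'\neq c\in\{1,\dots,K\},\ i\in\{1,\dots,n\},$$ over $W_L\in\mathbb{R}^{K\times d}$, $W_{L-1},\dots,W_1\in\mathbb{R}^{d\times d}$, $H_1\in\mathbb{R}^{d\times nK}$, where $z_{ic}$ is the column of $Z=W_LW_{L-1}\cdots W_1H_1$ indexed by sample $i$ of class $c$. Let $\Theta^*=(W_L^*,\dots,W_1^*,H_1^* )$ be a DNC point, i.e. a parameter tuple satisfying the balancedness relations $(W_l^* )^TW_l^*=W_{l-1}^*(W_{l-1}^* )^T$ for $l=1,\dots,L$ (with $W_0^*:=H_1^*$) and whose logit matrix is $Z(\Theta^* )=S\otimes 1_n^T$ (so all constraints are tight). If either $L=2$ and $K\ge 6$, or $L\ge 3$ and $K\ge 4$, then: (i) $\Theta^*$ is not a global minimizer of (P), i.e. there exists a feasible tuple with strictly smaller objective value; and (ii) $\Theta^*$ is a local minimizer of (P), i.e. there is a neighbourhood of $\Theta^*$ in which every feasible tuple has objective value at least that of $\Theta^*$. In particular (P) has multiple distinct local minima.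
   Context: $S=I_K-\frac1K 1_K1_K^T$ is the simplex ETF matrix; $1_m$ is the all-ones vector in $\mathbb{R}^m$; $\otimes$ is the Kronecker product; $\|\cdot\|_F$ is the Frobenius norm. The $nK$ columns of $H_1$ (and of $Z$) are ordered by class: column $(c-1)n+i$ corresponds to sample $i$ of class $c$, and $(z_{ic})_c$ denotes the $c$-th entry of that column. *)

theory Defs
  imports "Jordan_Normal_Form.Matrix"
begin

(* Parameters: Ws l for l = 1..L (W_1,...,W_L), H = H_1.  Values of Ws outside 1..L are irrelevant. *)

fun chain :: "(nat \<Rightarrow> real mat) \<Rightarrow> real mat \<Rightarrow> nat \<Rightarrow> real mat" where
  "chain Ws H 0 = H"
| "chain Ws H (Suc l) = Ws (Suc l) * chain Ws H l"

definition logits :: "nat \<Rightarrow> (nat \<Rightarrow> real mat) \<Rightarrow> real mat \<Rightarrow> real mat" where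
  "logits L Ws H = chain Ws H L"

definition frob_sq :: "real mat \<Rightarrow> real" where
  "frob_sq A = (\<Sum>i<dim_row A. \<Sum>j<dim_col A. (A $$ (i,j))\<^sup>2)"

definition objective :: "nat \<Rightarrow> (nat \<Rightarrow> real mat) \<Rightarrow> real mat \<Rightarrow> real" where
  "objective L Ws H = frob_sq H + (\<Sum>l=1..L. frob_sq (Ws l))"

definition well_shaped :: "nat \<Rightarrow> nat \<Rightarrow> nat \<Rightarrow> nat \<Rightarrow> (nat \<Rightarrow> real mat) \<Rightarrow> real mat \<Rightarrow> bool" where
  "well_shaped K n L d Ws H \<longleftrightarrow>
     Ws L \<in> carrier_mat K d \<and> (\<forall>l. 1 \<le> l \<and> l < L \<longrightarrow> Ws l \<in> carrier_mat d d) \<and>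
     H \<in> carrier_mat d (n * K)"

(* Classes and samples are 0-indexed: column c*n+i is sample i of class c (c<K, i<n). *)
definition feasible :: "nat \<Rightarrow> nat \<Rightarrow> nat \<Rightarrow> (nat \<Rightarrow> real mat) \<Rightarrow> real mat \<Rightarrow> bool" where
  "feasible K n L Ws H \<longleftrightarrow>
     (\<forall>c<K. \<forall>c'<K. \<forall>i<n. c' \<noteq> c \<longrightarrow>
        (logits L Ws H) $$ (c, c*n+i) - (logits L Ws H) $$ (c', c*n+i) \<ge> 1)"

(* S \<otimes> 1_n^T with S = I_K - (1/K) 1 1^T *)
definition etf_logits :: "nat \<Rightarrow> nat \<Rightarrow> real mat" where
  "etf_logits K n = mat K (n * K)
     (\<lambda>(r, j). (if r = j div n then 1 else 0) - 1 / real K)"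

definition balanced :: "nat \<Rightarrow> (nat \<Rightarrow> real mat) \<Rightarrow> real mat \<Rightarrow> bool" where
  "balanced L Ws H \<longleftrightarrow>
     (\<forall>l. 1 \<le> l \<and> l \<le> L \<longrightarrow>
        transpose_mat (Ws l) * Ws l =
        (if l = 1 then H * transpose_mat H else Ws (l-1) * transpose_mat (Ws (l-1))))"

definition DNC_point :: "nat \<Rightarrow> nat \<Rightarrow> nat \<Rightarrow> nat \<Rightarrow> (nat \<Rightarrow> real mat) \<Rightarrow> real mat \<Rightarrow> bool" where
  "DNC_point K n L d Ws H \<longleftrightarrow>
     well_shaped K n L d Ws H \<and> balanced L Ws H \<and> logits L Ws H = etf_logits K n"

definition param_dist_sq :: "nat \<Rightarrow> (nat \<Rightarrow> real mat) \<Rightarrow> real mat \<Rightarrow> (nat \<Rightarrow> real mat) \<Rightarrow> real mat \<Rightarrow> real" where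
  "param_dist_sq L Ws H Ws' H' = frob_sq (H' - H) + (\<Sum>l=1..L. frob_sq (Ws' l - Ws l))"

end

theory Submission
  imports Defs "Jordan_Normal_Form.Determinant" "HOL-Analysis.Convex"
begin

text \<open>
  Put \<open>q = K - 1\<close> and let \<open>U\<close> be a \<open>q \<times> K\<close> matrix with \<open>U U\<^sup>T = I\<close> and \<open>U\<^sup>T U = S\<close>. Compressing the
  logits to \<open>P = U Z (U \<otimes> 1\<^sub>n\<^sup>T)\<^sup>T / \<surd>n\<close> turns the logits of a DNC point into \<open>\<surd>n I\<close>. Peeling off the
  factors of \<open>Z\<close> one at a time by LQ decompositions bounds \<open>(det P)\<^sup>2\<close> by the product over all layers
  of \<open>(\<parallel>W\<^sub>l\<parallel>\<^sup>2 / q)\<^sup>q\<close>, so by AM-GM the objective is at least \<open>(L + 1) q n powr (1 / (L + 1))\<close> whenever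
  \<open>(det P)\<^sup>2 \<ge> n\<^sup>q\<close>. For feasible \<open>Z\<close> one has \<open>P = \<surd>n (I + E)\<close> where \<open>tr E\<close> is \<open>1 / K\<close> times the total
  constraint slack, which also bounds the entries of \<open>E\<close>; hence \<open>det (I + E) \<ge> 1\<close> near a DNC point.

  A DNC point attains this bound: balancedness makes all layers equally large and gives
  \<open>G ^ (L + 1) = n S\<close> for \<open>G = W\<^sub>L W\<^sub>L\<^sup>T\<close>, and convexity of the normalised moments \<open>k \<mapsto> v \<bullet> G\<^sup>k v / t\<^sup>k\<close> with
  \<open>t ^ (L + 1) = n\<close> bounds the trace of \<open>G\<close> by \<open>q t\<close>. The cross-polytope logits, of rank about \<open>K / 2\<close>,
  are strictly cheaper.
\<close>

section \<open>LQ decomposition\<close>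

text \<open>AM-GM with the root cleared. The factors will be squares that may vanish, so a zero
  product is treated separately when the \<open>powr\<close> is undone.\<close>

lemma prod_le_mean_power:
  fixes x :: "'a \<Rightarrow> real"
  assumes "finite S" "S \<noteq> {}" and nonneg: "\<And>i. i \<in> S \<Longrightarrow> x i \<ge> 0"
  shows "(\<Prod>i\<in>S. x i) \<le> ((\<Sum>i\<in>S. x i) / card S) ^ card S"
proof -
  have c: "card S > 0" using assms by (simp add: card_gt_0_iff)
  have p: "(\<Prod>i\<in>S. x i) \<ge> 0" using nonneg by (intro prod_nonneg) auto
  have "(\<Prod>i\<in>S. x i) powr (1 / card S) \<le> (\<Sum>i\<in>S. x i) / card S"
    using arith_geom_mean[OF assms(1,2) nonneg] by (simp add: sum_divide_distrib)
  then have "((\<Prod>i\<in>S. x i) powr (1 / card S)) ^ card S \<le> ((\<Sum>i\<in>S. x i) / card S) ^ card S"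
    by (intro power_mono) auto
  moreover have "((\<Prod>i\<in>S. x i) powr (1 / card S)) ^ card S = (\<Prod>i\<in>S. x i)"
    using c p by (cases "(\<Prod>i\<in>S. x i) = 0") (auto simp: powr_realpow[symmetric] powr_powr)
  ultimately show ?thesis by simp
qed

lemma index_mult_mat_sum:
  assumes "A \<in> carrier_mat a b" "B \<in> carrier_mat b c" "i < a" "j < c"
  shows "(A * B) $$ (i,j) = (\<Sum>k<b. A $$ (i,k) * B $$ (k,j))"
  using assms by (auto simp: scalar_prod_def lessThan_atLeast0)

text \<open>Families of vectors are plain functions read only at indices below \<open>k\<close> and
  \<open>d\<close>, so Gram-Schmidt can append a vector by the update \<open>q(k := e)\<close>
  without changing any dimension.\<close>

definition orthonormal_rows :: "nat \<Rightarrow> nat \<Rightarrow> (nat \<Rightarrow> nat \<Rightarrow> real) \<Rightarrow> bool" where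
  "orthonormal_rows k d q \<longleftrightarrow>
     (\<forall>i<k. \<forall>j<k. (\<Sum>t<d. q i t * q j t) = (if i = j then 1 else 0))"

lemma orthonormal_rowsD:
  "orthonormal_rows k d q \<Longrightarrow> i < k \<Longrightarrow> j < k \<Longrightarrow> (\<Sum>t<d. q i t * q j t) = (if i = j then 1 else 0)"
  by (simp add: orthonormal_rows_def)

lemma residual_orthogonal:
  assumes q: "orthonormal_rows k d q" and j: "j < k"
  shows "(\<Sum>t<d. (w t - (\<Sum>i<k. (\<Sum>s<d. q i s * w s) * q i t)) * q j t) = 0"
proof -
  have "(\<Sum>t<d. (\<Sum>i<k. (\<Sum>s<d. q i s * w s) * q i t) * q j t)
      = (\<Sum>i<k. (\<Sum>s<d. q i s * w s) * (\<Sum>t<d. q i t * q j t))"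
    unfolding sum_distrib_right sum_distrib_left
    by (subst sum.swap) (simp add: mult.assoc)
  also have "\<dots> = (\<Sum>i<k. (\<Sum>s<d. q i s * w s) * (if i = j then 1 else 0))"
    by (intro sum.cong refl) (use q j in \<open>simp add: orthonormal_rowsD\<close>)
  also have "\<dots> = (\<Sum>s<d. q j s * w s)"
    using j by (simp add: if_distrib[where f = "(*) x" for x] cong: if_cong)
  finally show ?thesis
    unfolding left_diff_distrib sum_subtractf by (simp add: mult.commute)
qed

text \<open>Pythagoras: the residual \<open>r\<close> is orthogonal to the projection, so its
  squared norm is the inner product of \<open>r\<close> with \<open>w\<close>.\<close>

lemma residual_norm:
  assumes q: "orthonormal_rows k d q"
  shows "(\<Sum>t<d. (w t - (\<Sum>i<k. (\<Sum>s<d. q i s * w s) * q i t))\<^sup>2)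
       = (\<Sum>t<d. (w t)\<^sup>2) - (\<Sum>i<k. (\<Sum>s<d. q i s * w s)\<^sup>2)"
proof -
  define c where "c i = (\<Sum>s<d. q i s * w s)" for i
  define r where "r t = w t - (\<Sum>i<k. c i * q i t)" for t
  have o: "(\<Sum>t<d. r t * q j t) = 0" if "j < k" for j
    using residual_orthogonal[OF q that, of w] by (simp add: r_def c_def)
  have "(\<Sum>t<d. (r t)\<^sup>2) = (\<Sum>t<d. r t * w t) - (\<Sum>t<d. r t * (\<Sum>i<k. c i * q i t))"
    by (simp add: sum_subtractf[symmetric] r_def power2_eq_square algebra_simps)
  also have "(\<Sum>t<d. r t * (\<Sum>i<k. c i * q i t)) = (\<Sum>i<k. c i * (\<Sum>t<d. r t * q i t))"
    unfolding sum_distrib_left by (subst sum.swap) (simp add: mult.left_commute)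
  also have "\<dots> = 0" by (simp add: o)
  also have "(\<Sum>t<d. r t * w t) = (\<Sum>t<d. (w t)\<^sup>2) - (\<Sum>t<d. (\<Sum>i<k. c i * q i t) * w t)"
    by (simp add: r_def left_diff_distrib sum_subtractf power2_eq_square)
  also have "(\<Sum>t<d. (\<Sum>i<k. c i * q i t) * w t) = (\<Sum>i<k. c i * (\<Sum>t<d. q i t * w t))"
    unfolding sum_distrib_right sum_distrib_left
    by (subst sum.swap) (simp add: mult.assoc)
  finally show ?thesis by (simp add: r_def c_def power2_eq_square)
qed

lemma bessel_inequality:
  assumes "orthonormal_rows k d q"
  shows "(\<Sum>i<k. (\<Sum>s<d. q i s * w s)\<^sup>2) \<le> (\<Sum>t<d. (w t)\<^sup>2)"
  using residual_norm[OF assms, of w]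
    sum_nonneg[of "{..<d}" "\<lambda>t. (w t - (\<Sum>i<k. (\<Sum>s<d. q i s * w s) * q i t))\<^sup>2"]
  by simp

text \<open>By \<open>residual_norm\<close> the inequality \<open>ne\<close> says exactly that the
  residual is nonzero, so it can be divided by its length \<open>c\<close>.\<close>

lemma normalised_residual:
  fixes w :: "nat \<Rightarrow> real"
  assumes q: "orthonormal_rows k d q"
    and ne: "(\<Sum>t<d. (w t)\<^sup>2) \<noteq> (\<Sum>i<k. (\<Sum>s<d. q i s * w s)\<^sup>2)"
  obtains e c where "(\<Sum>t<d. e t * e t) = 1" "\<And>j. j < k \<Longrightarrow> (\<Sum>t<d. e t * q j t) = 0"
    "\<And>t. w t = (\<Sum>i<k. (\<Sum>s<d. q i s * w s) * q i t) + c * e t"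
proof -
  define r where "r t = w t - (\<Sum>i<k. (\<Sum>s<d. q i s * w s) * q i t)" for t
  define c where "c = sqrt (\<Sum>t<d. (r t)\<^sup>2)"
  have "(\<Sum>t<d. (r t)\<^sup>2) \<noteq> 0" using residual_norm[OF q, of w] ne by (simp add: r_def)
  moreover have "(\<Sum>t<d. (r t)\<^sup>2) \<ge> 0" by (simp add: sum_nonneg)
  ultimately have c: "c \<noteq> 0" "c * c = (\<Sum>t<d. (r t)\<^sup>2)" by (auto simp: c_def)
  have "(\<Sum>t<d. r t / c * (r t / c)) = (\<Sum>t<d. (r t)\<^sup>2) / (c * c)"
    by (simp add: sum_divide_distrib power2_eq_square)
  then have 1: "(\<Sum>t<d. r t / c * (r t / c)) = 1" using c by (metis divide_self_if mult_eq_0_iff)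
  have 2: "(\<Sum>t<d. r t / c * q j t) = 0" if "j < k" for j
    using residual_orthogonal[OF q that, of w] by (simp add: r_def sum_divide_distrib[symmetric])
  show ?thesis by (rule that[of "\<lambda>t. r t / c" c]) (use 1 2 c in \<open>auto simp: r_def\<close>)
qed

text \<open>If every standard basis vector attained equality in Bessel's inequality, summing these
  equalities over the basis would give d = k. Hence some basis vector has a nonzero residual, which
  is normalised.\<close>

lemma exists_orthogonal_unit:
  assumes q: "orthonormal_rows k d q" and "k < d"
  obtains e where "(\<Sum>t<d. e t * e t) = (1::real)" "\<And>j. j < k \<Longrightarrow> (\<Sum>t<d. e t * q j t) = 0"
proof -
  have "\<exists>u<d. (\<Sum>t<d. (if t = u then 1 else 0 :: real)\<^sup>2) \<noteq>
      (\<Sum>i<k. (\<Sum>s<d. q i s * (if s = u then 1 else 0))\<^sup>2)"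
  proof (rule ccontr)
    assume "\<not> ?thesis"
    then have "(\<Sum>u<d. (\<Sum>t<d. (if t = u then 1 else 0 :: real)\<^sup>2))
        = (\<Sum>u<d. (\<Sum>i<k. (\<Sum>s<d. q i s * (if s = u then 1 else 0))\<^sup>2))"
      by (intro sum.cong[OF refl]) blast
    moreover have "(\<Sum>u<d. (\<Sum>t<d. (if t = u then 1 else 0 :: real)\<^sup>2)) = real d"
      by (simp add: if_distrib[of "\<lambda>x. x\<^sup>2"] cong: if_cong)
    moreover have "(\<Sum>u<d. (\<Sum>i<k. (\<Sum>s<d. q i s * (if s = u then 1 else 0))\<^sup>2)) =
        (\<Sum>u<d. \<Sum>i<k. q i u * q i u)"
      by (intro sum.cong refl) (auto simp: power2_eq_square if_distrib[where f = "(*) x" for x] cong: if_cong)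
    moreover have "\<dots> = (\<Sum>i<k. \<Sum>u<d. q i u * q i u)" by (rule sum.swap)
    moreover have "\<dots> = real k" using orthonormal_rowsD[OF q] by simp
    ultimately show False using \<open>k < d\<close> by simp
  qed
  then obtain u where ne: "(\<Sum>t<d. (if t = u then 1 else 0 :: real)\<^sup>2) \<noteq>
      (\<Sum>i<k. (\<Sum>s<d. q i s * (if s = u then 1 else 0))\<^sup>2)" by blast
  show ?thesis by (rule normalised_residual[OF q ne]) (rule that)
qed

text \<open>A vector already in the span takes c = 0 and any orthogonal unit vector for
  \<open>e\<close>; so linearly dependent rows are covered.\<close>

lemma gram_schmidt_extend:
  fixes w :: "nat \<Rightarrow> real"
  assumes q: "orthonormal_rows k d q" and "k < d"
  obtains e c where "(\<Sum>t<d. e t * e t) = 1" "\<And>j. j < k \<Longrightarrow> (\<Sum>t<d. e t * q j t) = 0"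
    "\<And>t. t < d \<Longrightarrow> w t = (\<Sum>i<k. (\<Sum>s<d. q i s * w s) * q i t) + c * e t"
proof (cases "(\<Sum>t<d. (w t)\<^sup>2) = (\<Sum>i<k. (\<Sum>s<d. q i s * w s)\<^sup>2)")
  case False
  show ?thesis by (rule normalised_residual[OF q False]) (rule that)
next
  case True
  obtain e where e: "(\<Sum>t<d. e t * e t) = (1::real)" "\<And>j. j < k \<Longrightarrow> (\<Sum>t<d. e t * q j t) = 0"
    using exists_orthogonal_unit[OF assms] by blast
  have "(\<Sum>t<d. (w t - (\<Sum>i<k. (\<Sum>s<d. q i s * w s) * q i t))\<^sup>2) = 0"
    using residual_norm[OF q, of w] True by simp
  then have "w t = (\<Sum>i<k. (\<Sum>s<d. q i s * w s) * q i t)" if "t < d" for t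
    using that by (subst (asm) sum_nonneg_eq_0_iff) auto
  then show ?thesis using that[OF e, of 0] by simp
qed

text \<open>The vanishing of \<open>T i j\<close> covers all j > i, also j at least
  \<open>k\<close>: in the induction the old rows then get coefficient 0 at the newly appended
  vector.\<close>

lemma gram_schmidt:
  fixes a :: "nat \<Rightarrow> nat \<Rightarrow> real"
  assumes "k \<le> d"
  obtains q T where "orthonormal_rows k d q"
    "\<And>i t. i < k \<Longrightarrow> t < d \<Longrightarrow> a i t = (\<Sum>j<k. T i j * q j t)"
    "\<And>i j. i < k \<Longrightarrow> i < j \<Longrightarrow> T i j = 0"
proof -
  have "\<exists>q T. orthonormal_rows k d q \<and>
     (\<forall>i<k. \<forall>t<d. a i t = (\<Sum>j<k. T i j * q j t)) \<and> (\<forall>i<k. \<forall>j>i. T i j = 0)"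
    using assms
  proof (induction k)
    case 0
    then show ?case by (auto simp: orthonormal_rows_def)
  next
    case (Suc k)
    then obtain q T where q: "orthonormal_rows k d q"
      and a: "\<And>i t. i < k \<Longrightarrow> t < d \<Longrightarrow> a i t = (\<Sum>j<k. T i j * q j t)"
      and T: "\<And>i j. i < k \<Longrightarrow> i < j \<Longrightarrow> T i j = 0" by auto
    obtain e c where e: "(\<Sum>t<d. e t * e t) = 1" "\<And>j. j < k \<Longrightarrow> (\<Sum>t<d. e t * q j t) = 0"
      "\<And>t. t < d \<Longrightarrow> a k t = (\<Sum>i<k. (\<Sum>s<d. q i s * a k s) * q i t) + c * e t"
      using gram_schmidt_extend[OF q, of "a k"] Suc.prems by auto
    have e': "(\<Sum>t<d. q j t * e t) = 0" if "j < k" for j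
      using e(2)[OF that] by (simp add: mult.commute)
    define T' where "T' i j = (if i < k then T i j else if j < k then (\<Sum>s<d. q j s * a k s)
       else if j = k then c else 0)" for i j
    have "orthonormal_rows (Suc k) d (q(k := e))"
      using orthonormal_rowsD[OF q] e e' unfolding orthonormal_rows_def
      by (auto simp: less_Suc_eq)
    moreover have "a i t = (\<Sum>j<Suc k. T' i j * (q(k := e)) j t)" if "i < Suc k" "t < d" for i t
    proof (cases "i < k")
      case True
      then show ?thesis using a[OF True that(2)] T[OF True, of k] by (simp add: T'_def)
    next
      case False
      then have "i = k" using that by simp
      then show ?thesis using e(3)[OF that(2)] by (simp add: T'_def)
    qed
    moreover have "T' i j = 0" if "i < Suc k" "i < j" for i j
      using that T by (auto simp: T'_def)
    ultimately show ?case by blast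
  qed
  then show ?thesis using that by blast
qed

lemma orthonormal_rows_iff_mat:
  assumes "Q \<in> carrier_mat k d"
  shows "Q * transpose_mat Q = 1\<^sub>m k \<longleftrightarrow> orthonormal_rows k d (\<lambda>i t. Q $$ (i,t))"
proof -
  have "(Q * transpose_mat Q) $$ (i,j) = (\<Sum>t<d. Q $$ (i,t) * Q $$ (j,t))" if "i < k" "j < k" for i j
    using assms that by (subst index_mult_mat_sum[of _ k d _ k]) auto
  then show ?thesis using assms unfolding orthonormal_rows_def mat_eq_iff by auto
qed

text \<open>Hadamard's inequality followed by AM-GM. Since \<open>T\<close> is lower triangular, its
  determinant is the product of the diagonal entries; each of them is the inner product of a row of
  \<open>A\<close> with a unit vector, hence at most the length of that row.\<close>

lemma LQ_decomposition:
  assumes A: "A \<in> carrier_mat q d" and "q \<le> d" "q > 0"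
  obtains T Q where "T \<in> carrier_mat q q" "Q \<in> carrier_mat q d" "Q * transpose_mat Q = 1\<^sub>m q"
    "A = T * Q" "(det T)\<^sup>2 \<le> (frob_sq A / q) ^ q"
proof -
  obtain f g where f: "orthonormal_rows q d f"
    and Ag: "\<And>i t. i < q \<Longrightarrow> t < d \<Longrightarrow> A $$ (i,t) = (\<Sum>j<q. g i j * f j t)"
    and g: "\<And>i j. i < q \<Longrightarrow> i < j \<Longrightarrow> g i j = 0"
    using gram_schmidt[OF \<open>q \<le> d\<close>, of "\<lambda>i t. A $$ (i,t)"] by metis
  define T where "T = mat q q (\<lambda>(i,j). g i j)"
  define Q where "Q = mat q d (\<lambda>(i,j). f i j)"
  have T: "T \<in> carrier_mat q q" and Q: "Q \<in> carrier_mat q d" by (auto simp: T_def Q_def)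
  have QQ: "Q * transpose_mat Q = 1\<^sub>m q"
    using f unfolding orthonormal_rows_iff_mat[OF Q] orthonormal_rows_def by (simp add: Q_def)
  have "A $$ (i,t) = (T * Q) $$ (i,t)" if "i < q" "t < d" for i t
    unfolding index_mult_mat_sum[OF T Q that] Ag[OF that] using that by (simp add: T_def Q_def)
  then have "A = T * Q" using A T Q by (intro eq_matI) auto
  have diag: "g i i = (\<Sum>t<d. f i t * A $$ (i,t))" if "i < q" for i
  proof -
    have "(\<Sum>t<d. f i t * A $$ (i,t)) = (\<Sum>t<d. \<Sum>j<q. g i j * (f i t * f j t))"
      by (intro sum.cong refl) (simp add: Ag[OF that] sum_distrib_left algebra_simps)
    also have "\<dots> = (\<Sum>j<q. g i j * (\<Sum>t<d. f i t * f j t))"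
      by (subst sum.swap) (simp add: sum_distrib_left)
    also have "\<dots> = (\<Sum>j<q. g i j * (if i = j then 1 else 0))"
      by (intro sum.cong refl) (use that orthonormal_rowsD[OF f] in auto)
    finally show ?thesis using that by (simp add: if_distrib[where f = "(*) x" for x] cong: if_cong)
  qed
  have le: "(g i i)\<^sup>2 \<le> (\<Sum>t<d. (A $$ (i,t))\<^sup>2)" if "i < q" for i
  proof -
    have "(g i i)\<^sup>2 \<le> (\<Sum>j<q. (\<Sum>t<d. f j t * A $$ (i,t))\<^sup>2)"
      unfolding diag[OF that] by (rule member_le_sum) (use that in auto)
    also have "\<dots> \<le> (\<Sum>t<d. (A $$ (i,t))\<^sup>2)" by (rule bessel_inequality[OF f])
    finally show ?thesis .
  qed
  have "det T = prod_list (diag_mat T)"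
    by (rule det_lower_triangular[OF _ T]) (auto simp: T_def g)
  also have "\<dots> = (\<Prod>i<q. g i i)"
    by (simp add: prod_list_diag_prod T_def lessThan_atLeast0)
  finally have "(det T)\<^sup>2 = (\<Prod>i<q. (g i i)\<^sup>2)" by (simp add: prod_power_distrib)
  also have "\<dots> \<le> ((\<Sum>i<q. (g i i)\<^sup>2) / q) ^ q"
    using prod_le_mean_power[of "{..<q}" "\<lambda>i. (g i i)\<^sup>2"] \<open>q > 0\<close> by auto
  also have "\<dots> \<le> (frob_sq A / q) ^ q"
    using A le by (intro power_mono divide_right_mono)
      (auto simp: frob_sq_def sum_nonneg intro!: sum_mono divide_nonneg_nonneg)
  finally show ?thesis using that[OF T Q QQ \<open>A = T * Q\<close>] by simp
qed

lemma frob_sq_transpose: "frob_sq (transpose_mat A) = frob_sq A"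
  unfolding frob_sq_def by (simp, subst sum.swap) (auto intro!: sum.cong)

text \<open>Bessel's inequality applied to each column of \<open>W\<close>.\<close>

lemma frob_sq_orthonormal_mult_le:
  assumes Q: "Q \<in> carrier_mat k d" and W: "W \<in> carrier_mat d m" and QQ: "Q * transpose_mat Q = 1\<^sub>m k"
  shows "frob_sq (Q * W) \<le> frob_sq W"
proof -
  have f: "orthonormal_rows k d (\<lambda>i t. Q $$ (i,t))" using QQ orthonormal_rows_iff_mat[OF Q] by simp
  have "frob_sq (Q * W) = (\<Sum>j<m. \<Sum>i<k. (\<Sum>s<d. Q $$ (i,s) * W $$ (s,j))\<^sup>2)"
    using Q W by (subst sum.swap) (simp add: frob_sq_def index_mult_mat_sum[OF Q W] del: index_mult_mat(1))
  also have "\<dots> \<le> (\<Sum>j<m. \<Sum>t<d. (W $$ (t,j))\<^sup>2)"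
    by (intro sum_mono bessel_inequality[OF f])
  also have "\<dots> = frob_sq W" using W by (subst sum.swap) (simp add: frob_sq_def)
  finally show ?thesis .
qed

section \<open>A determinantal lower bound for the objective\<close>

lemma det_sq_orthogonal:
  assumes Q: "(Q :: real mat) \<in> carrier_mat k k" and QQ: "Q * transpose_mat Q = 1\<^sub>m k"
  shows "(det Q)\<^sup>2 = 1"
proof -
  have "det (Q * transpose_mat Q) = det Q * det Q"
    using Q by (simp add: det_mult[of _ k] det_transpose[OF Q])
  then show ?thesis using QQ by (simp add: power2_eq_square)
qed

lemma frob_sq_nonneg: "frob_sq A \<ge> 0"
  by (simp add: frob_sq_def sum_nonneg)

lemma chain_carrier:
  assumes "H \<in> carrier_mat d m" "\<And>j. 1 \<le> j \<Longrightarrow> j \<le> l \<Longrightarrow> Ws j \<in> carrier_mat d d"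
  shows "chain Ws H l \<in> carrier_mat d m"
  using assms by (induction l) (auto intro!: mult_carrier_mat[of _ d d])

lemma well_shapedD:
  assumes "well_shaped K n L d Ws H"
  shows "H \<in> carrier_mat d (n * K)" "Ws L \<in> carrier_mat K d"
    "\<And>l. 1 \<le> l \<Longrightarrow> l < L \<Longrightarrow> Ws l \<in> carrier_mat d d"
    "\<And>l. l < L \<Longrightarrow> chain Ws H l \<in> carrier_mat d (n * K)"
  using assms chain_carrier[of H d "n * K" _ Ws] by (auto simp: well_shaped_def)

lemma logits_Suc:
  assumes "L \<ge> 1" shows "logits L Ws H = Ws L * chain Ws H (L - 1)"
  using assms by (cases L) (auto simp: logits_def)

lemma logits_carrier:
  assumes "well_shaped K n L d Ws H" "L \<ge> 1"
  shows "logits L Ws H \<in> carrier_mat K (n * K)"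
  using well_shapedD[OF assms(1)] assms(2) by (auto simp: logits_Suc)

text \<open>The LQ decomposition of a row-orthonormal compression peels off one factor of a matrix product
  and leaves a row-orthonormal compression of the remaining factors.\<close>

lemma compressed_factor:
  assumes Q: "Q \<in> carrier_mat q a" "Q * transpose_mat Q = 1\<^sub>m q" and W: "W \<in> carrier_mat a d"
    and X: "X \<in> carrier_mat d m" and V: "V \<in> carrier_mat m q" and q: "q \<le> d" "0 < q"
  obtains Q' where "Q' \<in> carrier_mat q d" "Q' * transpose_mat Q' = 1\<^sub>m q"
    "(det (Q * (W * X) * V))\<^sup>2 \<le> (frob_sq W / q) ^ q * (det (Q' * X * V))\<^sup>2"
proof -
  obtain T Q' where T: "T \<in> carrier_mat q q" and Q': "Q' \<in> carrier_mat q d" "Q' * transpose_mat Q' = 1\<^sub>m q"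
    and eq: "Q * W = T * Q'" and dt: "(det T)\<^sup>2 \<le> (frob_sq (Q * W) / q) ^ q"
    using LQ_decomposition[of "Q * W" q d] Q W q by auto
  have "Q * (W * X) * V = T * (Q' * X * V)"
  proof -
    have "Q * (W * X) = T * (Q' * X)"
      using assoc_mult_mat[OF Q(1) W X] assoc_mult_mat[OF T Q'(1) X] eq by simp
    then show ?thesis using assoc_mult_mat[OF T _ V, of "Q' * X"] Q' X by simp
  qed
  then have "(det (Q * (W * X) * V))\<^sup>2 = (det T)\<^sup>2 * (det (Q' * X * V))\<^sup>2"
    using T Q' X V by (simp add: det_mult[of _ q] power_mult_distrib)
  also have "(det T)\<^sup>2 \<le> (frob_sq W / q) ^ q"
    by (rule order_trans[OF dt])
      (use frob_sq_orthonormal_mult_le[OF Q(1) W Q(2)] in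
        \<open>auto intro!: power_mono divide_right_mono divide_nonneg_nonneg frob_sq_nonneg\<close>)
  finally show ?thesis using that[OF Q'] by (auto simp: mult_right_mono)
qed

text \<open>The bottom of the peeling. Here the LQ decomposition is that of a square matrix, so its
  second factor is orthogonal and has squared determinant 1. Compressing on the right by
  \<open>V\<close> is compressing the transpose on the left.\<close>

lemma det_compressed_le:
  assumes Q: "Q \<in> carrier_mat q d" "Q * transpose_mat Q = 1\<^sub>m q" and H: "H \<in> carrier_mat d m"
    and V: "V \<in> carrier_mat m q" "transpose_mat V * V = 1\<^sub>m q" and q: "0 < q"
  shows "(det (Q * H * V))\<^sup>2 \<le> (frob_sq H / q) ^ q"
proof -
  obtain T R where T: "T \<in> carrier_mat q q" and R: "R \<in> carrier_mat q q" "R * transpose_mat R = 1\<^sub>m q"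
    and eq: "Q * H * V = T * R" and dt: "(det T)\<^sup>2 \<le> (frob_sq (Q * H * V) / q) ^ q"
    using LQ_decomposition[of "Q * H * V" q q] Q H V q by auto
  have "frob_sq (Q * H * V) = frob_sq (transpose_mat V * transpose_mat (Q * H))"
    using transpose_mult[of "Q * H" q m V q] Q H V frob_sq_transpose[of "Q * H * V"] by simp
  also have "\<dots> \<le> frob_sq (transpose_mat (Q * H))"
    using Q H V by (intro frob_sq_orthonormal_mult_le[of _ q m _ q]) auto
  also have "\<dots> \<le> frob_sq H"
    unfolding frob_sq_transpose using frob_sq_orthonormal_mult_le[OF Q(1) H Q(2)] .
  finally have "frob_sq (Q * H * V) \<le> frob_sq H" .
  then have "(det T)\<^sup>2 \<le> (frob_sq H / q) ^ q"
    using dt by (elim order_trans) (auto intro!: power_mono divide_right_mono divide_nonneg_nonneg frob_sq_nonneg)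
  then show ?thesis
    unfolding eq using T R det_sq_orthogonal[OF R] by (simp add: det_mult[of _ q] power_mult_distrib)
qed

text \<open>Each peeled layer replaces \<open>Q\<close> by another row-orthonormal matrix, so the
  induction is over arbitrary \<open>Q\<close>, while \<open>V\<close> stays fixed on the
  right.\<close>

lemma det_compressed_chain_le:
  assumes "Q \<in> carrier_mat q d" "Q * transpose_mat Q = 1\<^sub>m q" and H: "H \<in> carrier_mat d m"
    and Ws: "\<And>j. 1 \<le> j \<Longrightarrow> j \<le> l \<Longrightarrow> Ws j \<in> carrier_mat d d"
    and V: "V \<in> carrier_mat m q" "transpose_mat V * V = 1\<^sub>m q" and q: "q \<le> d" "0 < q"
  shows "(det (Q * chain Ws H l * V))\<^sup>2 \<le> (frob_sq H / q) ^ q * (\<Prod>j=1..l. (frob_sq (Ws j) / q) ^ q)"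
  using assms(1,2) Ws
proof (induction l arbitrary: Q)
  case 0
  then show ?case using det_compressed_le[OF _ _ H V q(2)] by simp
next
  case (Suc l)
  have X: "chain Ws H l \<in> carrier_mat d m" using Suc.prems H by (intro chain_carrier) auto
  obtain Q' where Q': "Q' \<in> carrier_mat q d" "Q' * transpose_mat Q' = 1\<^sub>m q"
    and le: "(det (Q * (Ws (Suc l) * chain Ws H l) * V))\<^sup>2
      \<le> (frob_sq (Ws (Suc l)) / q) ^ q * (det (Q' * chain Ws H l * V))\<^sup>2"
    using compressed_factor[OF Suc.prems(1,2) _ X V(1) q, of "Ws (Suc l)"] Suc.prems(3) by auto
  have "(det (Q' * chain Ws H l * V))\<^sup>2 \<le> (frob_sq H / q) ^ q * (\<Prod>j=1..l. (frob_sq (Ws j) / q) ^ q)"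
    using Suc.prems(3) by (intro Suc.IH[OF Q']) auto
  then have "(det (Q * chain Ws H (Suc l) * V))\<^sup>2 \<le> (frob_sq (Ws (Suc l)) / q) ^ q *
      ((frob_sq H / q) ^ q * (\<Prod>j=1..l. (frob_sq (Ws j) / q) ^ q))"
    unfolding chain.simps
    by (intro order_trans[OF le] mult_left_mono) (auto simp: frob_sq_nonneg)
  then show ?case by (simp add: mult_ac)
qed

text \<open>The top layer has K rows instead of d, so it is peeled off by hand before the chain
  bound applies to the layers below. A second AM-GM, over the L + 1 factors, turns the product of
  their energies into the objective.\<close>

lemma objective_ge_of_det:
  assumes ws: "well_shaped K n L d Ws H" and "L \<ge> 1" and q: "q \<le> d" "0 < q"
    and U: "U \<in> carrier_mat q K" "U * transpose_mat U = 1\<^sub>m q"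
    and V: "V \<in> carrier_mat (n * K) q" "transpose_mat V * V = 1\<^sub>m q"
    and det: "(det (U * logits L Ws H * V))\<^sup>2 \<ge> real n ^ q"
  shows "objective L Ws H \<ge> real (L + 1) * real q * root (L + 1) n"
proof -
  \<comment> \<open>The energy of a factor per retained dimension, with the features
    \<open>H\<close> counted as layer 0.\<close>
  define x where "x j = frob_sq (if j = 0 then H else Ws j) / q" for j
  have x0: "x j \<ge> 0" for j by (simp add: x_def frob_sq_nonneg)
  note wsD = well_shapedD[OF ws]
  obtain Q' where Q': "Q' \<in> carrier_mat q d" "Q' * transpose_mat Q' = 1\<^sub>m q"
    and le: "(det (U * (Ws L * chain Ws H (L - 1)) * V))\<^sup>2
      \<le> (frob_sq (Ws L) / q) ^ q * (det (Q' * chain Ws H (L - 1) * V))\<^sup>2"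
    by (rule compressed_factor[OF U wsD(2) wsD(4)[of "L - 1"] V(1) q]) (use \<open>L \<ge> 1\<close> in auto)
  have "real n ^ q \<le> (frob_sq (Ws L) / q) ^ q * (det (Q' * chain Ws H (L - 1) * V))\<^sup>2"
    using det le \<open>L \<ge> 1\<close> by (simp add: logits_Suc)
  also have "\<dots> \<le> (frob_sq (Ws L) / q) ^ q *
      ((frob_sq H / q) ^ q * (\<Prod>j=1..L-1. (frob_sq (Ws j) / q) ^ q))"
    using wsD by (intro mult_left_mono det_compressed_chain_le[OF Q' _ _ V q])
      (auto simp: frob_sq_nonneg)
  also have "\<dots> = (\<Prod>j\<le>L. x j) ^ q"
  proof -
    have xL: "x L = frob_sq (Ws L) / q" "x 0 = frob_sq H / q" using \<open>L \<ge> 1\<close> by (auto simp: x_def)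
    have "{..L} = insert L (insert 0 {1..L-1})" using \<open>L \<ge> 1\<close> by auto
    then have "(\<Prod>j\<le>L. x j) = x L * (x 0 * (\<Prod>j=1..L-1. x j))" using \<open>L \<ge> 1\<close> by simp
    also have "(\<Prod>j=1..L-1. x j) = (\<Prod>j=1..L-1. frob_sq (Ws j) / q)"
      by (intro prod.cong) (auto simp: x_def)
    finally show ?thesis by (simp only: xL power_mult_distrib prod_power_distrib)
  qed
  finally have "real n \<le> (\<Prod>j\<le>L. x j)"
    using q(2) x0 by (meson power_le_imp_le_base power_mono_iff prod_nonneg of_nat_0_le_iff)
  also have "\<dots> \<le> ((\<Sum>j\<le>L. x j) / (L + 1)) ^ (L + 1)"
    using prod_le_mean_power[of "{..L}" x] x0 by simp
  finally have "root (L + 1) n \<le> root (L + 1) (((\<Sum>j\<le>L. x j) / (L + 1)) ^ (L + 1))"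
    by simp
  also have "\<dots> = (\<Sum>j\<le>L. x j) / (L + 1)"
    by (intro real_root_power_cancel) (auto intro!: divide_nonneg_nonneg sum_nonneg x0)
  also have "(\<Sum>j\<le>L. x j) = objective L Ws H / q"
  proof -
    have "{..L} = insert 0 {1..L}" by auto
    then have "(\<Sum>j\<le>L. x j) = x 0 + (\<Sum>j=1..L. x j)" by simp
    also have "(\<Sum>j=1..L. x j) = (\<Sum>j=1..L. frob_sq (Ws j) / q)"
      by (intro sum.cong) (auto simp: x_def)
    finally show ?thesis by (simp add: x_def objective_def sum_divide_distrib add_divide_distrib)
  qed
  finally have "root (L + 1) n \<le> objective L Ws H / (real (L + 1) * real q)"
    by (simp add: mult.commute)
  then show ?thesis
    using q by (subst (asm) pos_le_divide_eq) (auto simp: mult.commute intro!: mult_pos_pos)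
qed

section \<open>First-order expansion of the determinant near the identity\<close>

text \<open>Appending a factor turns the error \<open>D\<close> into D (1 + x) + s x, where
  \<open>s\<close> is the sum so far. As |1 + x| is at most 2, the constant grows from 4^q to at
  most 2 * 4^q + q, which is below 4^(q+1).\<close>

lemma prod_one_plus_approx:
  fixes x :: "nat \<Rightarrow> real"
  assumes "\<And>i. i < q \<Longrightarrow> \<bar>x i\<bar> \<le> e" "e \<le> 1" "0 \<le> e"
  shows "\<bar>(\<Prod>i<q. 1 + x i) - 1 - (\<Sum>i<q. x i)\<bar> \<le> 4 ^ q * e\<^sup>2"
  using assms(1)
proof (induction q)
  case 0
  then show ?case by simp
next
  case (Suc q)
  define D where "D = (\<Prod>i<q. 1 + x i) - 1 - (\<Sum>i<q. x i)"
  define s where "s = (\<Sum>i<q. x i)"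
  have D: "\<bar>D\<bar> \<le> 4 ^ q * e\<^sup>2" using Suc by (simp add: D_def)
  have xq: "\<bar>x q\<bar> \<le> e" using Suc.prems by simp
  have "\<bar>s\<bar> \<le> (\<Sum>i<q. \<bar>x i\<bar>)" unfolding s_def by (rule sum_abs)
  also have "\<dots> \<le> (\<Sum>i<q. e)" using Suc.prems by (intro sum_mono) auto
  finally have s: "\<bar>s\<bar> \<le> real q * e" by simp
  have "real q \<le> 2 ^ q" using of_nat_less_two_power[of q] by (rule less_imp_le)
  also have "\<dots> \<le> 4 ^ q" by (rule power_mono) auto
  finally have "real q \<le> 4 ^ q" .
  have "(\<Prod>i<Suc q. 1 + x i) - 1 - (\<Sum>i<Suc q. x i) = D * (1 + x q) + s * x q"
    by (simp add: D_def s_def algebra_simps)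
  also have "\<bar>\<dots>\<bar> \<le> \<bar>D\<bar> * \<bar>1 + x q\<bar> + \<bar>s\<bar> * \<bar>x q\<bar>"
    by (metis abs_mult abs_triangle_ineq)
  also have "\<dots> \<le> (4 ^ q * e\<^sup>2) * 2 + (real q * e) * e"
    using D s xq assms(2,3) by (intro add_mono mult_mono) auto
  also have "\<dots> = (2 * 4 ^ q + real q) * e\<^sup>2" by (simp add: power2_eq_square algebra_simps)
  also have "\<dots> \<le> 4 ^ Suc q * e\<^sup>2"
  proof (rule mult_right_mono)
    have "(0::real) \<le> 4 ^ q" by simp
    then show "2 * 4 ^ q + real q \<le> 4 ^ Suc q" unfolding power_Suc using \<open>real q \<le> 4 ^ q\<close> by linarith
  qed simp
  finally show ?case .
qed

text \<open>Leibniz expansion. The identity permutation gives the product of the diagonal, whose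
  linear part is the trace. Every other permutation moves at least two indices, so its term has two
  factors of size at most e, and the rest are at most 2.\<close>

lemma det_one_plus_ge:
  fixes E :: "real mat"
  assumes E: "E \<in> carrier_mat q q" and e: "\<And>i j. i < q \<Longrightarrow> j < q \<Longrightarrow> \<bar>E $$ (i,j)\<bar> \<le> e"
    and "0 \<le> e" "e \<le> 1"
  shows "det (1\<^sub>m q + E) \<ge> 1 + (\<Sum>i<q. E $$ (i,i)) - (4 ^ q + fact q * 2 ^ q) * e\<^sup>2"
proof -
  define F where "F = (\<lambda>p. signof p * (\<Prod>i=0..<q. (1\<^sub>m q + E) $$ (i, p i)) :: real)"
  define P where "P = {p. p permutes {0..<q}}"
  have fin: "finite P" "id \<in> P" and cP: "card P = fact q"
    by (auto simp: P_def finite_permutations permutes_id card_permutations)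
  have ent: "(1\<^sub>m q + E) $$ (i,j) = (if i = j then 1 else 0) + E $$ (i,j)" if "i < q" "j < q" for i j
    using that E by simp
  have small: "\<bar>F p\<bar> \<le> 2 ^ q * e\<^sup>2" if p: "p \<in> P" "p \<noteq> id" for p
  proof -
    have perm: "p permutes {0..<q}" using p by (simp add: P_def)
    have pl: "p i < q" if "i < q" for i using permutes_in_image[OF perm, of i] that by simp
    obtain i where i: "p i \<noteq> i" using p(2) by (auto simp: fun_eq_iff)
    then have iq: "i < q" using perm by (meson atLeastLessThan_iff le0 permutes_not_in)
    \<comment> \<open>The image of a moved index is a second moved index, by injectivity of
      \<open>p\<close>.\<close>
    define j where "j = p i"
    have j: "j < q" "j \<noteq> i" "p j \<noteq> j" using pl[OF iq] i permutes_inj[OF perm]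
      by (auto simp: j_def dest: injD)
    have "\<bar>F p\<bar> = (\<Prod>k=0..<q. \<bar>(1\<^sub>m q + E) $$ (k, p k)\<bar>)"
      by (simp add: F_def abs_mult abs_prod sign_def)
    also have "\<dots> \<le> (\<Prod>k=0..<q. if k = i \<or> k = j then e else 2)"
    proof (rule prod_mono)
      fix k assume "k \<in> {0..<q}"
      then have "k < q" "p k < q" using pl by auto
      then show "0 \<le> \<bar>(1\<^sub>m q + E) $$ (k, p k)\<bar> \<and> \<bar>(1\<^sub>m q + E) $$ (k, p k)\<bar> \<le> (if k = i \<or> k = j then e else 2)"
        using e[of k "p k"] i j(3) \<open>e \<le> 1\<close> by (auto simp: ent[of k "p k"])
    qed
    also have "\<dots> = (\<Prod>k\<in>{i,j}. e) * (\<Prod>k\<in>{0..<q} - {i,j}. 2)"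
      using iq j by (subst prod.subset_diff[of "{i,j}"]) (auto simp: mult.commute intro!: arg_cong2[where f = "(*)"] prod.cong)
    also have "\<dots> = e\<^sup>2 * 2 ^ card ({0..<q} - {i,j})"
      using j by (simp add: power2_eq_square)
    also have "\<dots> \<le> e\<^sup>2 * 2 ^ q"
      by (intro mult_left_mono power_increasing) (auto intro: order_trans[OF card_mono[of "{0..<q}"]])
    finally show ?thesis by (simp add: mult.commute)
  qed
  have "det (1\<^sub>m q + E) = (\<Sum>p\<in>P. F p)"
    unfolding F_def P_def by (rule det_def') (use E in auto)
  also have "\<dots> = F id + (\<Sum>p\<in>P - {id}. F p)" using fin by (simp add: sum.remove)
  finally have 1: "det (1\<^sub>m q + E) = F id + (\<Sum>p\<in>P - {id}. F p)" .
  have "\<bar>\<Sum>p\<in>P - {id}. F p\<bar> \<le> (\<Sum>p\<in>P - {id}. 2 ^ q * e\<^sup>2)"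
    by (rule order_trans[OF sum_abs], rule sum_mono, rule small) auto
  also have "\<dots> \<le> (\<Sum>p\<in>P. 2 ^ q * e\<^sup>2)" using fin by (intro sum_mono2) auto
  also have "\<dots> = fact q * 2 ^ q * e\<^sup>2" by (simp add: cP)
  finally have 2: "\<bar>\<Sum>p\<in>P - {id}. F p\<bar> \<le> fact q * 2 ^ q * e\<^sup>2" .
  have "F id = (\<Prod>i<q. 1 + E $$ (i,i))"
    by (auto simp: F_def ent lessThan_atLeast0 signof_id intro!: prod.cong)
  then have 3: "\<bar>F id - 1 - (\<Sum>i<q. E $$ (i,i))\<bar> \<le> 4 ^ q * e\<^sup>2"
    using prod_one_plus_approx[of q "\<lambda>i. E $$ (i,i)" e] e assms(3,4) by simp
  show ?thesis using 1 2 3 by (simp add: algebra_simps)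
qed

section \<open>Compression of the logits\<close>

lemma sum_blocks:
  fixes f :: "nat \<Rightarrow> 'a::comm_monoid_add"
  shows "(\<Sum>j<n * K. f j) = (\<Sum>c<K. \<Sum>i<n. f (c * n + i))"
proof -
  have "sum f {c * n..<c * n + n} = (\<Sum>i<n. f (c * n + i))" for c
    using sum.shift_bounds_nat_ivl[of f 0 "c * n" n] by (simp add: add.commute lessThan_atLeast0)
  then show ?thesis using sum.nat_group[of f n K] by (simp add: mult.commute)
qed

lemma sum_delta_minus:
  fixes a :: real and i q :: nat
  assumes "i < q"
  shows "(\<Sum>c<q. ((if i = c then 1 else 0) - a) * g c) = g i - a * (\<Sum>c<q. g c)"
proof -
  have "(\<Sum>c<q. ((if i = c then 1 else 0) - a) * g c) = (\<Sum>c<q. (if i = c then g c else 0) - a * g c)"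
    by (intro sum.cong) (auto simp: left_diff_distrib)
  also have "\<dots> = (\<Sum>c<q. if i = c then g c else 0) - (\<Sum>c<q. a * g c)"
    by (rule sum_subtractf)
  finally show ?thesis using assms by (simp add: sum_distrib_left)
qed

lemma sum_delta_minus_prod:
  fixes a :: real
  assumes "i < q" "j < q"
  shows "(\<Sum>c<q. ((if i = c then 1 else 0) - a) * ((if j = c then 1 else 0) - a))
    = (if i = j then 1 else 0) - 2 * a + a * (real q * a)"
proof -
  have "(\<Sum>c<q. (if j = c then 1 else 0) - a) = 1 - real q * a"
    using assms by (simp add: sum_subtractf)
  then show ?thesis
    unfolding sum_delta_minus[OF assms(1)] by (simp only:) (simp add: algebra_simps)
qed

text \<open>The first \<open>K - 1\<close> rows of the Householder reflection that maps the last unit vector to the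
  normalised all-ones vector.\<close>

definition frame :: "nat \<Rightarrow> nat \<Rightarrow> nat \<Rightarrow> real" where
  "frame K i c = (if c = K - 1 then - 1 / sqrt K
     else (if i = c then 1 else 0) - (1 - 1 / sqrt K) / (real K - 1))"

context
  fixes K :: nat assumes K: "K \<ge> 2"
begin

lemma frame_row_sum: "i < K - 1 \<Longrightarrow> (\<Sum>c<K. frame K i c) = 0"
proof -
  assume i: "i < K - 1"
  obtain q where q: "K = Suc q" "q \<ge> 1" using K by (cases K) auto
  have "(\<Sum>c<q. frame K i c) = (\<Sum>c<q. (if i = c then 1 else 0) - (1 - 1 / sqrt K) / q)"
    by (intro sum.cong) (auto simp: frame_def q)
  also have "\<dots> = 1 - (1 - 1 / sqrt K)"
    using i q by (simp add: sum_subtractf)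
  finally show ?thesis by (simp add: q frame_def)
qed

lemma frame_orthonormal: "orthonormal_rows (K - 1) K (frame K)"
  unfolding orthonormal_rows_def
proof (intro allI impI)
  fix i j assume ij: "i < K - 1" "j < K - 1"
  obtain q where q: "K = Suc q" "q \<ge> 1" using K by (cases K) auto
  define b where "b = 1 / sqrt K"
  define a where "a = (1 - b) / q"
  have b2: "b * b = 1 / (q + 1)" using q by (simp add: b_def)
  have qa: "real q * a = 1 - b" using q by (simp add: a_def)
  have fr: "frame K k c = (if k = c then 1 else 0) - a" if "c < q" for k c
    using that by (auto simp: frame_def q a_def b_def)
  have fq: "frame K k q = - b" for k by (simp add: frame_def q b_def)
  have Kset: "{..<K} = insert q {..<q}" using q by auto
  have "(\<Sum>c<q. frame K i c * frame K j c) =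
      (\<Sum>c<q. ((if i = c then 1 else 0) - a) * ((if j = c then 1 else 0) - a))"
    by (intro sum.cong) (auto simp: fr)
  also have "\<dots> = (if i = j then 1 else 0) - 2 * a + a * (real q * a)"
    using ij q by (intro sum_delta_minus_prod) auto
  finally have "(\<Sum>c<K. frame K i c * frame K j c) =
      (if i = j then 1 else 0) + (a * (real q * a) - 2 * a + b * b)"
    by (simp add: Kset fq)
  \<comment> \<open>Multiplying by \<open>q\<close> lets q a = 1 - b eliminate \<open>a\<close>:
    what remains is (1 - b)^2 - 2 (1 - b) + q b^2 = (q + 1) b^2 - 1 = 0.\<close>
  also have "a * (real q * a) - 2 * a + b * b = 0"
  proof -
    have "real q * (a * (real q * a) - 2 * a + b * b) = (real q * a) * (real q * a) - 2 * (real q * a) + real q * (b * b)"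
      by (simp add: algebra_simps)
    also have "\<dots> = real (q + 1) * (b * b) - 1" unfolding qa by (simp add: algebra_simps)
    also have "\<dots> = 0" by (simp add: b2)
    finally show ?thesis using q by simp
  qed
  finally show "(\<Sum>c<K. frame K i c * frame K j c) = (if i = j then 1 else 0)" by simp
qed

text \<open>The complementary relation U^T U = S, which later evaluates the trace of the
  perturbation. The cases separate the last column of the frame, which has its own formula.\<close>

lemma frame_gram:
  assumes c: "c < K" "c' < K"
  shows "(\<Sum>i<K - 1. frame K i c * frame K i c') = (if c = c' then 1 else 0) - 1 / K"
proof -
  obtain q where q: "K = Suc q" "q \<ge> 1" using K by (cases K) auto
  define b where "b = 1 / sqrt K"
  define a where "a = (1 - b) / q"
  have b2: "b * b = 1 / K" by (simp add: b_def)
  have qa: "real q * a = 1 - b" using q by (simp add: a_def)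
  have fr: "frame K k c = (if k = c then 1 else 0) - a" if "c < q" for k c
    using that by (auto simp: frame_def q a_def b_def)
  have fq: "frame K k q = - b" for k by (simp add: frame_def q b_def)
  have a0: "a * (real q * a) - 2 * a = - (b * b)"
  proof -
    have "real q * (a * (real q * a) - 2 * a) = (real q * a) * (real q * a) - 2 * (real q * a)"
      by (simp add: algebra_simps)
    also have "\<dots> = b * b - 1" unfolding qa by (simp add: algebra_simps)
    also have "\<dots> = real q * (- (b * b))" using q by (simp add: b2 field_simps)
    finally show ?thesis using q by (subst (asm) mult_left_cancel) auto
  qed
  have single: "(\<Sum>i<q. frame K i c) = b" if "c < q" for c
    using that by (simp add: fr sum_subtractf qa)
  have "(\<Sum>i<q. frame K i c * frame K i c') = (if c = c' then 1 else 0) - b * b"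
  proof (cases "c < q")
    case cq: True
    show ?thesis
    proof (cases "c' < q")
      case True
      have "(\<Sum>i<q. frame K i c * frame K i c') =
        (\<Sum>i<q. ((if c = i then 1 else 0) - a) * ((if c' = i then 1 else 0) - a))"
        by (intro sum.cong) (auto simp: fr True cq)
      also have "\<dots> = (if c = c' then 1 else 0) - 2 * a + a * (real q * a)"
        by (rule sum_delta_minus_prod[OF cq True])
      finally show ?thesis using a0 by linarith
    next
      case False
      then have "c' = q" using c q by simp
      then show ?thesis using single[OF cq] cq by (simp add: fq sum_distrib_right[symmetric] sum_negf)
    qed
  next
    case False
    then have cq: "c = q" using c q by simp
    show ?thesis
    proof (cases "c' < q")
      case True
      then show ?thesis using single[OF True] cq by (simp add: fq sum_distrib_left[symmetric] sum_negf)
    next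
      case False
      then have "c' = q" using c q by simp
      then have "(\<Sum>i<q. frame K i c * frame K i c') = real q * (1 / K)" using cq by (simp add: fq b2)
      also have "\<dots> = 1 - 1 / K" using q by (simp add: field_simps)
      finally show ?thesis using cq \<open>c' = q\<close> by (simp add: b2)
    qed
  qed
  then show ?thesis by (simp add: b2 q)
qed

lemma frame_abs_le: "i < K - 1 \<Longrightarrow> c < K \<Longrightarrow> \<bar>frame K i c\<bar> \<le> 1"
proof -
  assume i: "i < K - 1" and c: "c < K"
  have "(frame K i c)\<^sup>2 \<le> (\<Sum>c<K. (frame K i c)\<^sup>2)"
    by (rule member_le_sum) (use c in auto)
  also have "\<dots> = 1" using orthonormal_rowsD[OF frame_orthonormal i i] by (simp add: power2_eq_square)
  finally show ?thesis by (simp add: abs_square_le_1)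
qed

end

section \<open>Constraint slack and the compressed logits\<close>

text \<open>The amount by which the margin of class \<open>c\<close> over class \<open>r\<close>,
  averaged over samples, exceeds 1. Averages suffice because the right compression is constant on
  each class block. For r = c the value is 0, so sums may run over all pairs.\<close>

definition slack :: "nat \<Rightarrow> real mat \<Rightarrow> nat \<Rightarrow> nat \<Rightarrow> real" where
  "slack n Z r c = (\<Sum>i<n. Z $$ (c, c*n+i) - Z $$ (r, c*n+i)) / n - (if r = c then 0 else 1)"

lemma slack_nonneg:
  assumes "feasible K n L Ws H" "n \<ge> 1" "r < K" "c < K"
  shows "slack n (logits L Ws H) r c \<ge> 0"
proof (cases "r = c")
  case False
  have "(\<Sum>i<n. (1::real)) \<le> (\<Sum>i<n. logits L Ws H $$ (c, c*n+i) - logits L Ws H $$ (r, c*n+i))"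
    using assms False unfolding feasible_def by (intro sum_mono) auto
  then show ?thesis using False \<open>n \<ge> 1\<close> by (simp add: slack_def field_simps)
qed (simp add: slack_def)

lemma block_index_less: "c < K \<Longrightarrow> i < n \<Longrightarrow> c * n + i < n * (K::nat)"
proof -
  assume "c < K" "i < n"
  then have "c * n + i < Suc c * n" by simp
  also have "\<dots> \<le> K * n" using \<open>c < K\<close> by (intro mult_le_mono1) simp
  finally show ?thesis by (simp add: mult.commute)
qed

lemma slack_etf_logits:
  assumes "n \<ge> 1" "r < K" "c < K"
  shows "slack n (etf_logits K n) r c = 0"
  using assms by (simp add: slack_def etf_logits_def block_index_less)

definition left_frame :: "nat \<Rightarrow> real mat" where
  "left_frame K = mat (K - 1) K (\<lambda>(i,c). frame K i c)"

text \<open>The transpose of U \<otimes> 1_n^T divided by sqrt n, which makes its columns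
  orthonormal.\<close>

definition right_frame :: "nat \<Rightarrow> nat \<Rightarrow> real mat" where
  "right_frame K n = mat (n * K) (K - 1) (\<lambda>(j,i). frame K i (j div n) / sqrt n)"

lemma left_frame:
  assumes "K \<ge> 2"
  shows "left_frame K \<in> carrier_mat (K - 1) K" "left_frame K * transpose_mat (left_frame K) = 1\<^sub>m (K - 1)"
proof -
  show c: "left_frame K \<in> carrier_mat (K - 1) K" by (simp add: left_frame_def)
  show "left_frame K * transpose_mat (left_frame K) = 1\<^sub>m (K - 1)"
    unfolding orthonormal_rows_iff_mat[OF c]
    using frame_orthonormal[OF assms] by (simp add: orthonormal_rows_def left_frame_def)
qed

lemma right_frame:
  assumes "K \<ge> 2" "n \<ge> 1"
  shows "right_frame K n \<in> carrier_mat (n * K) (K - 1)"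
    "transpose_mat (right_frame K n) * right_frame K n = 1\<^sub>m (K - 1)"
proof -
  show c: "right_frame K n \<in> carrier_mat (n * K) (K - 1)" by (simp add: right_frame_def)
  have ct: "transpose_mat (right_frame K n) \<in> carrier_mat (K - 1) (n * K)" using c by simp
  have "(\<Sum>t<n * K. transpose_mat (right_frame K n) $$ (i,t) * transpose_mat (right_frame K n) $$ (j,t))
      = (if i = j then 1 else 0)" if "i < K - 1" "j < K - 1" for i j
  proof -
    have "(\<Sum>t<n * K. transpose_mat (right_frame K n) $$ (i,t) * transpose_mat (right_frame K n) $$ (j,t))
      = (\<Sum>t<n * K. frame K i (t div n) * frame K j (t div n) / n)"
      using that c \<open>n \<ge> 1\<close> by (intro sum.cong) (auto simp: right_frame_def)
    also have "\<dots> = (\<Sum>c<K. \<Sum>t<n. frame K i c * frame K j c / n)"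
      unfolding sum_blocks by (intro sum.cong refl) (use \<open>n \<ge> 1\<close> in auto)
    also have "\<dots> = (\<Sum>c<K. frame K i c * frame K j c)" using \<open>n \<ge> 1\<close> by simp
    finally show ?thesis using orthonormal_rowsD[OF frame_orthonormal[OF assms(1)] that] by simp
  qed
  then have "transpose_mat (right_frame K n) * transpose_mat (transpose_mat (right_frame K n)) = 1\<^sub>m (K - 1)"
    unfolding orthonormal_rows_iff_mat[OF ct] orthonormal_rows_def by blast
  then show "transpose_mat (right_frame K n) * right_frame K n = 1\<^sub>m (K - 1)" by simp
qed

text \<open>Exchanging the sums produces the entries of S = U^T U. The diagonal ones meet zero slack
  and the others are all -1/K, so the trace of the perturbation is a positive multiple of the total
  slack.\<close>

lemma sum_diag_slack:
  assumes "K \<ge> 2" and s0: "\<And>c. s c c = 0"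
  shows "(\<Sum>a<K - 1. - (\<Sum>r<K. \<Sum>c<K. frame K a r * frame K a c * s r c)) = (\<Sum>r<K. \<Sum>c<K. s r c) / K"
proof -
  have "(\<Sum>a<K - 1. \<Sum>r<K. \<Sum>c<K. frame K a r * frame K a c * s r c)
      = (\<Sum>r<K. \<Sum>c<K. \<Sum>a<K - 1. frame K a r * frame K a c * s r c)"
    by (subst sum.swap, subst (2) sum.swap, rule refl)
  also have "\<dots> = (\<Sum>r<K. \<Sum>c<K. - s r c / K)"
  proof (intro sum.cong refl)
    fix r c assume "r \<in> {..<K}" "c \<in> {..<K}"
    then have "(\<Sum>a<K - 1. frame K a r * frame K a c * s r c) = ((if r = c then 1 else 0) - 1 / K) * s r c"
      using frame_gram[OF assms(1), of r c] by (simp add: sum_distrib_right[symmetric])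
    also have "\<dots> = - s r c / K" using s0 by auto
    finally show "(\<Sum>a<K - 1. frame K a r * frame K a c * s r c) = - s r c / K" .
  qed
  finally show ?thesis by (simp add: sum_negf sum_divide_distrib)
qed

lemma compressed_logits:
  assumes "K \<ge> 2" "n \<ge> 1" and Z: "Z \<in> carrier_mat K (n * K)"
  shows "left_frame K * Z * right_frame K n = sqrt n \<cdot>\<^sub>m (1\<^sub>m (K - 1) +
    mat (K - 1) (K - 1) (\<lambda>(a,b). - (\<Sum>r<K. \<Sum>c<K. frame K a r * frame K b c * slack n Z r c)))"
    (is "?P = ?R")
proof (rule eq_matI)
  note U = left_frame(1)[OF assms(1)] and V = right_frame(1)[OF assms(1,2)]
  have UZ: "left_frame K * Z \<in> carrier_mat (K - 1) (n * K)" using U Z by simp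
  fix a b assume "a < dim_row ?R" "b < dim_col ?R"
  then have ab: "a < K - 1" "b < K - 1" by auto
  have avg: "(\<Sum>i<n. Z $$ (r, c*n+i)) / n
      = (\<Sum>i<n. Z $$ (c, c*n+i)) / n - 1 + (if r = c then 1 else 0) - slack n Z r c" for r c
    by (simp add: slack_def sum_subtractf diff_divide_distrib)
  have "?P $$ (a,b) = (\<Sum>j<n * K. (\<Sum>r<K. frame K a r * Z $$ (r,j)) * (frame K b (j div n) / sqrt n))"
    unfolding index_mult_mat_sum[OF UZ V ab]
  proof (intro sum.cong refl)
    fix j assume "j \<in> {..<n * K}"
    then have j: "j < n * K" by simp
    have "(left_frame K * Z) $$ (a,j) = (\<Sum>r<K. frame K a r * Z $$ (r,j))"
      unfolding index_mult_mat_sum[OF U Z ab(1) j]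
      by (intro sum.cong refl) (use ab in \<open>simp add: left_frame_def\<close>)
    moreover have "right_frame K n $$ (j,b) = frame K b (j div n) / sqrt n"
      using j ab by (simp add: right_frame_def)
    ultimately show "(left_frame K * Z) $$ (a,j) * right_frame K n $$ (j,b)
       = (\<Sum>r<K. frame K a r * Z $$ (r,j)) * (frame K b (j div n) / sqrt n)" by simp
  qed
  also have "\<dots> = (\<Sum>c<K. \<Sum>i<n. (\<Sum>r<K. frame K a r * Z $$ (r,c*n+i)) * (frame K b c / sqrt n))"
    unfolding sum_blocks by (intro sum.cong refl) (use \<open>n \<ge> 1\<close> in auto)
  also have "\<dots> = (\<Sum>c<K. sqrt n * frame K b c * (\<Sum>r<K. frame K a r * ((\<Sum>i<n. Z $$ (r,c*n+i)) / n)))"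
  proof (intro sum.cong refl)
    fix c
    have eq: "(\<Sum>i<n. (\<Sum>r<K. frame K a r * Z $$ (r,c*n+i)) * (frame K b c / sqrt n))
       = (\<Sum>r<K. frame K a r * (\<Sum>i<n. Z $$ (r,c*n+i))) * (frame K b c / sqrt n)"
      unfolding sum_distrib_right[symmetric] sum_distrib_left by (subst sum.swap) (rule refl)
    have "frame K b c / sqrt n = sqrt n * frame K b c / n"
      using \<open>n \<ge> 1\<close> by (simp add: field_simps)
    then show "(\<Sum>i<n. (\<Sum>r<K. frame K a r * Z $$ (r,c*n+i)) * (frame K b c / sqrt n))
      = sqrt n * frame K b c * (\<Sum>r<K. frame K a r * ((\<Sum>i<n. Z $$ (r,c*n+i)) / n))"
      unfolding eq by (simp add: sum_divide_distrib[symmetric])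
  qed
  also have "\<dots> = (\<Sum>c<K. sqrt n * frame K b c * (frame K a c - (\<Sum>r<K. frame K a r * slack n Z r c)))"
  proof (intro sum.cong refl arg_cong2[where f = "(*)"])
    fix c assume c: "c \<in> {..<K}"
    \<comment> \<open>The part of the class average that depends on the column class only; it is
      annihilated because the rows of the frame sum to zero. The Kronecker delta yields the identity
      matrix and the slack yields the perturbation.\<close>
    define z where "z = (\<Sum>i<n. Z $$ (c, c*n+i)) / n - 1"
    have avg': "(\<Sum>i<n. Z $$ (r, c*n+i)) / n = z + (if r = c then 1 else 0) - slack n Z r c" for r
      unfolding z_def by (rule avg)
    have "(\<Sum>r<K. frame K a r * ((\<Sum>i<n. Z $$ (r,c*n+i)) / n)) =
      (\<Sum>r<K. frame K a r * z + (if r = c then frame K a r else 0) - frame K a r * slack n Z r c)"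
      unfolding avg' by (intro sum.cong refl) (auto simp: algebra_simps)
    also have "\<dots> = (\<Sum>r<K. frame K a r) * z + frame K a c - (\<Sum>r<K. frame K a r * slack n Z r c)"
      using c by (simp add: sum.distrib sum_subtractf sum_distrib_right)
    finally show "(\<Sum>r<K. frame K a r * ((\<Sum>i<n. Z $$ (r,c*n+i)) / n))
        = frame K a c - (\<Sum>r<K. frame K a r * slack n Z r c)"
      using frame_row_sum[OF assms(1) ab(1)] by simp
  qed
  also have "\<dots> = sqrt n * ((\<Sum>c<K. frame K a c * frame K b c)
      - (\<Sum>c<K. \<Sum>r<K. frame K a r * frame K b c * slack n Z r c))"
    unfolding sum_subtractf[symmetric] sum_distrib_left
    by (intro sum.cong refl) (simp add: right_diff_distrib sum_distrib_left mult_ac)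
  also have "(\<Sum>c<K. \<Sum>r<K. frame K a r * frame K b c * slack n Z r c)
      = (\<Sum>r<K. \<Sum>c<K. frame K a r * frame K b c * slack n Z r c)" by (rule sum.swap)
  also have "(\<Sum>c<K. frame K a c * frame K b c) = (if a = b then 1 else 0)"
    using orthonormal_rowsD[OF frame_orthonormal[OF assms(1)] ab] .
  finally show "?P $$ (a,b) = ?R $$ (a,b)" using ab by simp
qed (use left_frame(1)[OF assms(1)] right_frame(1)[OF assms(1,2)] in auto)

text \<open>Feasibility makes the trace of the perturbation linear in the total slack, while its entries are
  bounded by the total slack; hence the first-order term of the determinant wins.\<close>

lemma det_compressed_logits_ge:
  assumes "K \<ge> 2" "n \<ge> 1" and Z: "Z \<in> carrier_mat K (n * K)"
    and nn: "\<And>r c. r < K \<Longrightarrow> c < K \<Longrightarrow> slack n Z r c \<ge> 0"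
    and small: "(\<Sum>r<K. \<Sum>c<K. slack n Z r c) \<le> 1 / (real K * (4 ^ (K - 1) + fact (K - 1) * 2 ^ (K - 1)))"
  shows "(det (left_frame K * Z * right_frame K n))\<^sup>2 \<ge> real n ^ (K - 1)"
proof -
  define \<sigma> where "\<sigma> = (\<Sum>r<K. \<Sum>c<K. slack n Z r c)"
  define C :: real where "C = 4 ^ (K - 1) + fact (K - 1) * 2 ^ (K - 1)"
  define E where "E = mat (K - 1) (K - 1) (\<lambda>(a,b). - (\<Sum>r<K. \<Sum>c<K. frame K a r * frame K b c * slack n Z r c))"
  have E: "E \<in> carrier_mat (K - 1) (K - 1)" by (simp add: E_def)
  have C1: "C \<ge> 1" unfolding C_def
    by (rule order_trans[of _ "4 ^ (K - 1)"]) auto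
  have \<sigma>0: "\<sigma> \<ge> 0" unfolding \<sigma>_def by (intro sum_nonneg) (auto simp: nn)
  have \<sigma>s: "\<sigma> \<le> 1 / (K * C)" using small by (simp add: \<sigma>_def C_def)
  have "1 * 1 \<le> real K * C" using C1 assms(1) by (intro mult_mono) auto
  then have "1 / (K * C) \<le> 1" by simp
  then have \<sigma>1: "\<sigma> \<le> 1" using \<sigma>s by linarith
  have bound: "\<bar>E $$ (a,b)\<bar> \<le> \<sigma>" if ab: "a < K - 1" "b < K - 1" for a b
  proof -
    have "\<bar>E $$ (a,b)\<bar> \<le> (\<Sum>r<K. \<Sum>c<K. \<bar>frame K a r * frame K b c * slack n Z r c\<bar>)"
      using ab by (simp add: E_def) (intro order_trans[OF sum_abs] sum_mono sum_abs)
    also have "\<dots> \<le> \<sigma>" unfolding \<sigma>_def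
    proof (intro sum_mono)
      fix r c assume rc: "r \<in> {..<K}" "c \<in> {..<K}"
      have "\<bar>frame K a r\<bar> * \<bar>frame K b c\<bar> * slack n Z r c \<le> 1 * 1 * slack n Z r c"
        using rc ab nn by (intro mult_mono frame_abs_le[OF assms(1)]) auto
      then show "\<bar>frame K a r * frame K b c * slack n Z r c\<bar> \<le> slack n Z r c"
        using rc nn by (simp add: abs_mult)
    qed
    finally show ?thesis .
  qed
  have "(\<Sum>a<K - 1. E $$ (a,a)) = \<sigma> / K"
    using sum_diag_slack[OF assms(1), of "slack n Z"] by (simp add: E_def \<sigma>_def slack_def)
  then have "det (1\<^sub>m (K - 1) + E) \<ge> 1 + \<sigma> / K - C * \<sigma>\<^sup>2"
    using det_one_plus_ge[OF E bound \<sigma>0 \<sigma>1] by (simp add: C_def)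
  \<comment> \<open>The threshold on the total slack is chosen for this: the second-order error is
    then absorbed by the trace term \<sigma> / K.\<close>
  moreover have "C * \<sigma>\<^sup>2 \<le> \<sigma> / K"
  proof -
    have "C * \<sigma>\<^sup>2 = C * \<sigma> * \<sigma>" by (simp add: power2_eq_square)
    also have "\<dots> \<le> C * (1 / (K * C)) * \<sigma>"
      using \<sigma>s \<sigma>0 C1 by (intro mult_right_mono mult_left_mono) auto
    also have "\<dots> = \<sigma> / K" using C1 by simp
    finally show ?thesis .
  qed
  ultimately have d: "det (1\<^sub>m (K - 1) + E) \<ge> 1" by linarith
  have "det (left_frame K * Z * right_frame K n) = sqrt n ^ (K - 1) * det (1\<^sub>m (K - 1) + E)"
    unfolding compressed_logits[OF assms(1-3)] E_def[symmetric] using E by simp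
  then have "(det (left_frame K * Z * right_frame K n))\<^sup>2 = real n ^ (K - 1) * (det (1\<^sub>m (K - 1) + E))\<^sup>2"
    by (simp add: power_mult_distrib power_even_eq[symmetric] flip: power_mult) (simp add: mult.commute power_mult)
  moreover have "real n ^ (K - 1) * 1 \<le> real n ^ (K - 1) * (det (1\<^sub>m (K - 1) + E))\<^sup>2"
    using d by (intro mult_left_mono) auto
  ultimately show ?thesis by simp
qed

lemma objective_ge_of_small_slack:
  assumes "K \<ge> 2" "n \<ge> 1" "L \<ge> 1" "d \<ge> K" and ws: "well_shaped K n L d Ws H"
    and f: "\<And>r c. r < K \<Longrightarrow> c < K \<Longrightarrow> slack n (logits L Ws H) r c \<ge> 0"
    and small: "(\<Sum>r<K. \<Sum>c<K. slack n (logits L Ws H) r c)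
      \<le> 1 / (real K * (4 ^ (K - 1) + fact (K - 1) * 2 ^ (K - 1)))"
  shows "objective L Ws H \<ge> real (L + 1) * real (K - 1) * root (L + 1) n"
  by (rule objective_ge_of_det[OF ws \<open>L \<ge> 1\<close> _ _ left_frame[OF assms(1)] right_frame[OF assms(1,2)]
        det_compressed_logits_ge[OF assms(1,2) logits_carrier[OF ws \<open>L \<ge> 1\<close>] f small]])
    (use assms in auto)

section \<open>Continuity of the logits\<close>

lemma entry_sq_le_frob_sq:
  assumes "i < dim_row A" "j < dim_col A"
  shows "(A $$ (i,j))\<^sup>2 \<le> frob_sq A"
proof -
  have "(A $$ (i,j))\<^sup>2 \<le> (\<Sum>j<dim_col A. (A $$ (i,j))\<^sup>2)"
    by (rule member_le_sum) (use assms in auto)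
  also have "\<dots> \<le> frob_sq A" unfolding frob_sq_def
    by (rule member_le_sum) (use assms in \<open>auto simp: sum_nonneg\<close>)
  finally show ?thesis .
qed

lemma well_shaped_layers:
  assumes "well_shaped K n L d Ws H" "L \<ge> 1" "l < L"
  shows "Ws (Suc l) \<in> carrier_mat (if Suc l = L then K else d) (if l = L then K else d)"
  using assms by (auto simp: well_shaped_def)

text \<open>The width function \<open>D\<close> lets one induction treat the square hidden layers
  and the top layer with K rows alike.\<close>

lemma chain_entry_tendsto:
  fixes X :: "nat \<Rightarrow> nat \<Rightarrow> real mat"
  assumes H: "H \<in> carrier_mat (D 0) m" and W: "\<And>l. l < L \<Longrightarrow> Ws (Suc l) \<in> carrier_mat (D (Suc l)) (D l)"
    and Y: "\<And>k. Y k \<in> carrier_mat (D 0) m" and X: "\<And>k l. l < L \<Longrightarrow> X k (Suc l) \<in> carrier_mat (D (Suc l)) (D l)"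
    and limY: "\<And>i j. i < D 0 \<Longrightarrow> j < m \<Longrightarrow> (\<lambda>k. Y k $$ (i,j)) \<longlonglongrightarrow> H $$ (i,j)"
    and limX: "\<And>l i j. l < L \<Longrightarrow> i < D (Suc l) \<Longrightarrow> j < D l \<Longrightarrow>
      (\<lambda>k. X k (Suc l) $$ (i,j)) \<longlonglongrightarrow> Ws (Suc l) $$ (i,j)"
    and "l \<le> L" "i < D l" "j < m"
  shows "(\<lambda>k. chain (X k) (Y k) l $$ (i,j)) \<longlonglongrightarrow> chain Ws H l $$ (i,j)"
  using assms(7-)
proof (induction l arbitrary: i)
  case 0
  then show ?case using limY by simp
next
  case (Suc l)
  have c: "chain V G l' \<in> carrier_mat (D l') m"
    if "G \<in> carrier_mat (D 0) m" "\<And>l. l < L \<Longrightarrow> V (Suc l) \<in> carrier_mat (D (Suc l)) (D l)" "l' \<le> L" for V G l'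
    using that(3) by (induction l') (auto intro!: mult_carrier_mat that)
  have lL: "l < L" "l \<le> L" using Suc.prems by auto
  have "(\<lambda>k. \<Sum>t<D l. X k (Suc l) $$ (i,t) * chain (X k) (Y k) l $$ (t,j))
      \<longlonglongrightarrow> (\<Sum>t<D l. Ws (Suc l) $$ (i,t) * chain Ws H l $$ (t,j))"
    using Suc.prems lL by (intro tendsto_sum tendsto_mult limX Suc.IH) auto
  then show ?case
    using Suc.prems index_mult_mat_sum[OF W[OF lL(1)] c[OF H W lL(2)], of i j]
      index_mult_mat_sum[OF X[OF lL(1)] c[OF Y X lL(2)], of i j] by simp
qed

text \<open>Sequential continuity: otherwise there are parameters converging to the given point
  whose total slack stays above e, although their logits converge entrywise to logits of zero
  slack.\<close>

lemma slack_small_nearby: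
  assumes "n \<ge> 1" "L \<ge> 1" and ws: "well_shaped K n L d Ws H" and "logits L Ws H = etf_logits K n"
    and e: "e > 0"
  shows "\<exists>\<epsilon>>0. \<forall>Ws' H'. well_shaped K n L d Ws' H' \<and> param_dist_sq L Ws H Ws' H' < \<epsilon> \<longrightarrow>
    (\<Sum>r<K. \<Sum>c<K. slack n (logits L Ws' H') r c) \<le> e"
proof (rule ccontr)
  assume neg: "\<not> ?thesis"
  have "\<exists>Ws' H'. well_shaped K n L d Ws' H' \<and> param_dist_sq L Ws H Ws' H' < inverse (real (Suc k)) \<and>
      (\<Sum>r<K. \<Sum>c<K. slack n (logits L Ws' H') r c) > e" for k
  proof -
    have "inverse (real (Suc k)) > 0" by simp
    then show ?thesis using neg by (meson not_le)
  qed
  then obtain X Y where wsX: "\<And>k. well_shaped K n L d (X k) (Y k)"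
    and dist: "\<And>k. param_dist_sq L Ws H (X k) (Y k) < inverse (real (Suc k))"
    and big: "\<And>k. (\<Sum>r<K. \<Sum>c<K. slack n (logits L (X k) (Y k)) r c) > e"
    by metis
  define D where "D l = (if l = L then K else d)" for l
  have D0: "D 0 = d" using \<open>L \<ge> 1\<close> by (simp add: D_def)
  have lim: "(\<lambda>k. A k $$ (i,j)) \<longlonglongrightarrow> B $$ (i,j)"
    if le: "\<And>k. frob_sq (A k - B) \<le> param_dist_sq L Ws H (X k) (Y k)"
      and c: "\<And>k. A k \<in> carrier_mat a b" "B \<in> carrier_mat a b" "i < a" "j < b" for A B a b i j
  proof -
    have "(\<lambda>k. A k $$ (i,j) - B $$ (i,j)) \<longlonglongrightarrow> 0"
    proof (rule tendsto_0_le[where K = 1])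
      show "(\<lambda>k. sqrt (inverse (real (Suc k)))) \<longlonglongrightarrow> 0"
        using tendsto_real_sqrt[OF LIMSEQ_inverse_real_of_nat] by simp
      have "\<bar>A k $$ (i,j) - B $$ (i,j)\<bar> \<le> sqrt (inverse (real (Suc k)))" for k
      proof -
        have "(A k $$ (i,j) - B $$ (i,j))\<^sup>2 = ((A k - B) $$ (i,j))\<^sup>2" using c(1)[of k] c(2-4) by simp
        also have "\<dots> \<le> frob_sq (A k - B)" using c by (intro entry_sq_le_frob_sq) auto
        also have "\<dots> \<le> inverse (real (Suc k))" using le[of k] dist[of k] by linarith
        finally show ?thesis by (intro real_le_rsqrt) simp
      qed
      then show "\<forall>\<^sub>F k in sequentially.
          norm (A k $$ (i,j) - B $$ (i,j)) \<le> norm (sqrt (inverse (real (Suc k)))) * 1"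
        by simp
    qed
    then show ?thesis by (simp add: LIM_zero_iff)
  qed
  have leH: "frob_sq (Y k - H) \<le> param_dist_sq L Ws H (X k) (Y k)" for k
    unfolding param_dist_sq_def by (simp add: sum_nonneg frob_sq_nonneg)
  have leW: "frob_sq (X k (Suc l) - Ws (Suc l)) \<le> param_dist_sq L Ws H (X k) (Y k)" if "l < L" for k l
  proof -
    have "frob_sq (X k (Suc l) - Ws (Suc l)) \<le> (\<Sum>l=1..L. frob_sq (X k l - Ws l))"
      by (rule member_le_sum) (use that in \<open>auto simp: frob_sq_nonneg\<close>)
    then show ?thesis unfolding param_dist_sq_def using frob_sq_nonneg[of "Y k - H"] by linarith
  qed
  have layers: "V (Suc l) \<in> carrier_mat (D (Suc l)) (D l)" if "well_shaped K n L d V G" "l < L" for V G l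
    unfolding D_def by (rule well_shaped_layers[OF that(1) \<open>L \<ge> 1\<close> that(2)])
  have cH: "H \<in> carrier_mat d (n * K)" "\<And>k. Y k \<in> carrier_mat d (n * K)"
    using ws wsX by (auto simp: well_shaped_def)
  have limZ: "(\<lambda>k. logits L (X k) (Y k) $$ (i,j)) \<longlonglongrightarrow> logits L Ws H $$ (i,j)" if "i < K" "j < n * K" for i j
    unfolding logits_def
  proof (rule chain_entry_tendsto[where D = D and L = L and m = "n * K"])
    show "H \<in> carrier_mat (D 0) (n * K)" "\<And>k. Y k \<in> carrier_mat (D 0) (n * K)" using cH by (auto simp: D0)
    show "Ws (Suc l) \<in> carrier_mat (D (Suc l)) (D l)" if "l < L" for l using layers[OF ws that] .
    show "X k (Suc l) \<in> carrier_mat (D (Suc l)) (D l)" if "l < L" for k l using layers[OF wsX that] .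
    show "(\<lambda>k. Y k $$ (i,j)) \<longlonglongrightarrow> H $$ (i,j)" if "i < D 0" "j < n * K" for i j
      using lim[OF leH cH(2,1)] that by (simp add: D0)
    show "(\<lambda>k. X k (Suc l) $$ (i,j)) \<longlonglongrightarrow> Ws (Suc l) $$ (i,j)"
      if "l < L" "i < D (Suc l)" "j < D l" for l i j
      using lim[OF leW[OF that(1)] layers[OF wsX that(1)] layers[OF ws that(1)] that(2,3)] .
  qed (use that in \<open>auto simp: D_def\<close>)
  have "(\<lambda>k. \<Sum>r<K. \<Sum>c<K. slack n (logits L (X k) (Y k)) r c)
      \<longlonglongrightarrow> (\<Sum>r<K. \<Sum>c<K. slack n (logits L Ws H) r c)"
    unfolding slack_def
    by (intro tendsto_sum tendsto_diff tendsto_divide tendsto_const limZ)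
      (use \<open>n \<ge> 1\<close> in \<open>auto simp: block_index_less\<close>)
  moreover have "(\<Sum>r<K. \<Sum>c<K. slack n (logits L Ws H) r c) = 0"
    unfolding assms(4) using \<open>n \<ge> 1\<close> by (simp add: slack_etf_logits)
  ultimately have "e \<le> 0"
    by (intro LIMSEQ_le_const[of _ 0 e]) (auto intro!: less_imp_le big)
  then show False using e by simp
qed

section \<open>The objective value of a DNC point\<close>

text \<open>The increments of a convex sequence never decrease, so a first step upwards would make
  the sequence strictly increasing and contradict \<open>M N \<le> M 0\<close>.\<close>

lemma convex_seq_first_le:
  fixes M :: "nat \<Rightarrow> real"
  assumes conv: "\<And>k. M (k + 2) - 2 * M (k + 1) + M k \<ge> 0" and "N \<ge> 1" "M N \<le> M 0"
  shows "M 1 \<le> M 0"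
proof (rule ccontr)
  assume "\<not> M 1 \<le> M 0"
  then have inc: "M (Suc k) > M k" for k
  proof (induction k)
    case (Suc k)
    then show ?case using conv[of k] by simp
  qed simp
  have "M 0 < M N" by (rule lift_Suc_mono_less[of M, OF inc]) (use \<open>N \<ge> 1\<close> in simp)
  then show False using assms(3) by simp
qed

section \<open>Moments of a symmetric kernel\<close>

definition apply_kernel :: "nat \<Rightarrow> (nat \<Rightarrow> nat \<Rightarrow> real) \<Rightarrow> (nat \<Rightarrow> real) \<Rightarrow> nat \<Rightarrow> real" where
  "apply_kernel K g x r = (\<Sum>s<K. g r s * x s)"

lemma moment_shift:
  assumes sym: "\<And>r s. r < K \<Longrightarrow> s < K \<Longrightarrow> g r s = g s r"
  shows "(\<Sum>r<K. apply_kernel K g x r * y r) = (\<Sum>r<K. x r * apply_kernel K g y r)"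
proof -
  have "(\<Sum>r<K. apply_kernel K g x r * y r) = (\<Sum>r<K. \<Sum>s<K. x s * (g r s * y r))"
    unfolding apply_kernel_def sum_distrib_right by (intro sum.cong refl) (simp add: mult_ac)
  also have "\<dots> = (\<Sum>s<K. \<Sum>r<K. x s * (g s r * y r))"
    by (subst sum.swap) (intro sum.cong refl, use sym in auto)
  finally show ?thesis by (simp add: apply_kernel_def sum_distrib_left)
qed

lemma moment_sum:
  assumes sym: "\<And>r s. r < K \<Longrightarrow> s < K \<Longrightarrow> g r s = g s r"
  shows "(\<Sum>r<K. (apply_kernel K g ^^ i) v r * (apply_kernel K g ^^ j) v r)
    = (\<Sum>r<K. v r * (apply_kernel K g ^^ (i + j)) v r)"
proof (induction i arbitrary: j)
  case (Suc i)
  have "(\<Sum>r<K. (apply_kernel K g ^^ Suc i) v r * (apply_kernel K g ^^ j) v r)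
     = (\<Sum>r<K. (apply_kernel K g ^^ i) v r * (apply_kernel K g ^^ Suc j) v r)"
    using moment_shift[of K g "(apply_kernel K g ^^ i) v", OF sym] by simp
  then show ?case by (simp only: Suc.IH add_Suc_right add_Suc)
qed simp

text \<open>A substitute for diagonalisation. The moments v . A^k v / t^k form a convex sequence
  with equal values at 0 and N. With w = A^(j+1) v / t - A^j v, the second difference is, up to a
  positive power of t, the squared norm of w for k = 2j and w . A w for k = 2j + 1; the latter is
  nonnegative by positive semidefiniteness.\<close>

lemma moment_first_le:
  fixes t :: real
  assumes sym: "\<And>r s. r < K \<Longrightarrow> s < K \<Longrightarrow> g r s = g s r"
    and psd: "\<And>x. (\<Sum>r<K. x r * apply_kernel K g x r) \<ge> 0"
    and "t > 0" "N \<ge> 1" and eig: "\<And>r. r < K \<Longrightarrow> (apply_kernel K g ^^ N) v r = t ^ N * v r"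
  shows "(\<Sum>r<K. v r * apply_kernel K g v r) \<le> t * (\<Sum>r<K. (v r)\<^sup>2)"
proof -
  define u where "u k = (apply_kernel K g ^^ k) v" for k
  define m where "m k = (\<Sum>r<K. v r * u k r)" for k
  have uu: "(\<Sum>r<K. u i r * u j r) = m (i + j)" for i j
    unfolding m_def u_def by (rule moment_sum[OF sym])
  have uS: "apply_kernel K g (u k) = u (Suc k)" for k by (simp add: u_def)
  have conv: "m (k + 2) / t\<^sup>2 - 2 * (m (k + 1) / t) + m k \<ge> 0" for k
  proof -
    define j where "j = k div 2"
    define w where "w r = u (j + 1) r / t - u j r" for r
    have Aw: "apply_kernel K g w r = u (j + 2) r / t - u (j + 1) r" for r
    proof -
      have "apply_kernel K g w r = apply_kernel K g (u (Suc j)) r / t - apply_kernel K g (u j) r"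
        by (simp add: apply_kernel_def w_def right_diff_distrib sum_subtractf sum_divide_distrib)
      then show ?thesis by (simp add: uS)
    qed
    have expand: "(\<Sum>r<K. (u (j + 1) r / t - u j r) * (u (i + 1) r / t - u i r))
       = m (j + i + 2) / t\<^sup>2 - 2 * (m (j + i + 1) / t) + m (j + i)" for i
    proof -
      have "(\<Sum>r<K. (u (j + 1) r / t - u j r) * (u (i + 1) r / t - u i r)) =
        (\<Sum>r<K. u (j + 1) r * u (i + 1) r / t\<^sup>2 - u (j + 1) r * u i r / t - u j r * u (i + 1) r / t + u j r * u i r)"
        by (intro sum.cong refl) (simp add: power2_eq_square algebra_simps)
      also have "\<dots> = m (j + 1 + (i + 1)) / t\<^sup>2 - m (j + 1 + i) / t - m (j + (i + 1)) / t + m (j + i)"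
        unfolding uu[symmetric] sum_divide_distrib by (simp add: sum.distrib sum_subtractf)
      finally show ?thesis by (simp add: add_ac)
    qed
    show ?thesis
    proof (cases "even k")
      case True
      then have k: "k = j + j" by (auto simp: j_def elim!: evenE)
      have "(\<Sum>r<K. w r * w r) \<ge> 0" by (simp add: sum_nonneg)
      then show ?thesis using expand[of j] by (simp add: w_def k)
    next
      case False
      then have k: "k = j + (j + 1)" by (auto simp: j_def elim!: oddE)
      have "(\<Sum>r<K. w r * apply_kernel K g w r) \<ge> 0" by (rule psd)
      then show ?thesis using expand[of "j + 1"] unfolding Aw by (simp add: w_def k add_ac)
    qed
  qed
  define M where "M k = m k / t ^ k" for k
  have "M 1 \<le> M 0"
  proof (rule convex_seq_first_le)
    fix k
    have "M (k + 2) - 2 * M (k + 1) + M k = (m (k + 2) / t\<^sup>2 - 2 * (m (k + 1) / t) + m k) / t ^ k"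
      using \<open>t > 0\<close> by (simp add: M_def field_simps power_add power2_eq_square)
    also have "\<dots> \<ge> 0" using conv[of k] \<open>t > 0\<close> by (intro divide_nonneg_nonneg) auto
    finally show "M (k + 2) - 2 * M (k + 1) + M k \<ge> 0" .
    have "m N = t ^ N * m 0"
      unfolding m_def u_def using eig by (simp add: sum_distrib_left algebra_simps)
    then show "M N \<le> M 0" using \<open>t > 0\<close> by (simp add: M_def)
  qed (rule \<open>N \<ge> 1\<close>)
  then have "m 1 \<le> t * m 0" using \<open>t > 0\<close> by (simp add: M_def field_simps)
  then show ?thesis by (simp add: m_def u_def power2_eq_square)
qed

text \<open>Descent on the exponent: by symmetry the squared norm of A^k v is the inner product of
  A^(k-1) v with A^(k+1) v, so it vanishes once A^(k+1) v does.\<close>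

lemma kernel_power_zero:
  assumes sym: "\<And>r s. r < K \<Longrightarrow> s < K \<Longrightarrow> g r s = g s r"
    and "N \<ge> 1" and zero: "\<And>r. r < K \<Longrightarrow> (apply_kernel K g ^^ N) v r = 0" and "r < K"
  shows "apply_kernel K g v r = 0"
proof -
  have "\<forall>r<K. (apply_kernel K g ^^ k) v r = 0" if "1 \<le> k" "k \<le> N" for k
    using that(2,1)
  proof (induction rule: inc_induct)
    case base
    then show ?case using zero by simp
  next
    case (step k)
    have "(\<Sum>r<K. ((apply_kernel K g ^^ k) v r)\<^sup>2)
        = (\<Sum>r<K. (apply_kernel K g ^^ (k - 1)) v r * (apply_kernel K g ^^ Suc k) v r)"
      using step.prems moment_sum[where K = K and g = g and v = v and i = k and j = k, OF sym]
        moment_sum[where K = K and g = g and v = v and i = "k - 1" and j = "Suc k", OF sym]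
      by (simp add: power2_eq_square)
    also have "\<dots> = 0" using step by (intro sum.neutral) auto
    finally show ?case by (subst (asm) sum_nonneg_eq_0_iff) auto
  qed
  from this[of 1] show ?thesis using assms by simp
qed

section \<open>Gram matrices of balanced layers and the value at a DNC point\<close>

lemma funpow_apply_kernel:
  assumes G: "G \<in> carrier_mat K K" and "r < K"
  shows "(apply_kernel K (\<lambda>r s. G $$ (r,s)) ^^ k) v r = (\<Sum>s<K. (G ^\<^sub>m k) $$ (r,s) * v s)"
proof (induction k arbitrary: v)
  case 0
  have "(\<Sum>s<K. (1\<^sub>m K) $$ (r,s) * v s) = (\<Sum>s<K. if s = r then v s else 0)"
    by (intro sum.cong) (use \<open>r < K\<close> in auto)
  then show ?case using G \<open>r < K\<close> by simp
next
  case (Suc k)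
  have Gk: "G ^\<^sub>m k \<in> carrier_mat K K" using G by simp
  have "(apply_kernel K (\<lambda>r s. G $$ (r,s)) ^^ Suc k) v r
      = (\<Sum>s<K. (G ^\<^sub>m k) $$ (r,s) * (\<Sum>t<K. G $$ (s,t) * v t))"
    unfolding funpow_Suc_right o_def Suc.IH by (simp add: apply_kernel_def)
  also have "\<dots> = (\<Sum>t<K. \<Sum>s<K. (G ^\<^sub>m k) $$ (r,s) * G $$ (s,t) * v t)"
    unfolding sum_distrib_left by (subst sum.swap) (simp add: mult.assoc)
  also have "\<dots> = (\<Sum>t<K. (G ^\<^sub>m Suc k) $$ (r,t) * v t)"
  proof (intro sum.cong refl)
    fix t assume "t \<in> {..<K}"
    then have "(G ^\<^sub>m Suc k) $$ (r,t) = (\<Sum>s<K. (G ^\<^sub>m k) $$ (r,s) * G $$ (s,t))"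
      using index_mult_mat_sum[OF Gk G \<open>r < K\<close>, of t] by simp
    then show "(\<Sum>s<K. (G ^\<^sub>m k) $$ (r,s) * G $$ (s,t) * v t) = (G ^\<^sub>m Suc k) $$ (r,t) * v t"
      by (simp add: sum_distrib_right)
  qed
  finally show ?case .
qed

lemma gram_power:
  assumes W: "W \<in> carrier_mat a b"
  shows "W * (transpose_mat W * W) ^\<^sub>m k * transpose_mat W = (W * transpose_mat W) ^\<^sub>m Suc k"
proof (induction k)
  case 0
  then show ?case using W by simp
next
  case (Suc k)
  define M where "M = (transpose_mat W * W) ^\<^sub>m k"
  have M: "M \<in> carrier_mat b b" and T: "transpose_mat W \<in> carrier_mat b a" using W by (auto simp: M_def)
  have "W * (M * (transpose_mat W * W)) * transpose_mat W = (W * M * transpose_mat W) * (W * transpose_mat W)"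
  proof -
    have "W * (M * (transpose_mat W * W)) = W * M * transpose_mat W * W"
      using assoc_mult_mat[OF W M, of "transpose_mat W * W" b] assoc_mult_mat[of "W * M" a b "transpose_mat W" a W b]
        W M T by simp
    also have "\<dots> * transpose_mat W = (W * M * transpose_mat W) * (W * transpose_mat W)"
      using W M T by (intro assoc_mult_mat) auto
    finally show ?thesis .
  qed
  then show ?case using Suc by (simp add: M_def)
qed

text \<open>Balancedness rewrites the Gram power of the previous layer as a power of W^T W, and
  \<open>gram_power\<close> moves it to the output side of \<open>W\<close>, raising the exponent by
  one. At l = L this expresses Z Z^T through the top layer alone.\<close>

lemma balanced_chain_gram:
  assumes ws: "well_shaped K n L d Ws H" and b: "balanced L Ws H" and "l \<le> L" "L \<ge> 1"
  shows "chain Ws H l * transpose_mat (chain Ws H l)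
    = (let W = if l = 0 then H else Ws l in (W * transpose_mat W) ^\<^sub>m Suc l)"
  using \<open>l \<le> L\<close>
proof (induction l)
  case 0
  have "H \<in> carrier_mat d (n * K)" using ws by (simp add: well_shaped_def)
  then show ?case by simp
next
  case (Suc l)
  define W where "W = Ws (Suc l)"
  define C where "C = chain Ws H l"
  define a where "a = (if Suc l = L then K else d)"
  have W: "W \<in> carrier_mat a d" using ws Suc.prems by (auto simp: well_shaped_def W_def a_def)
  have C: "C \<in> carrier_mat d (n * K)" using well_shapedD(4)[OF ws, of l] Suc.prems by (simp add: C_def)
  have WW: "transpose_mat W * W = (let W = if l = 0 then H else Ws l in W * transpose_mat W)"
    using b[unfolded balanced_def, rule_format, of "Suc l"] Suc.prems by (simp add: W_def Let_def)
  have CC: "C * transpose_mat C = (transpose_mat W * W) ^\<^sub>m Suc l"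
    using Suc.IH Suc.prems unfolding WW by (simp add: C_def Let_def)
  have "W * C * transpose_mat (W * C) = W * (C * transpose_mat C) * transpose_mat W"
  proof -
    have T: "transpose_mat W \<in> carrier_mat d a" "transpose_mat C \<in> carrier_mat (n * K) d" using W C by auto
    have "W * C * (transpose_mat C * transpose_mat W) = W * (C * (transpose_mat C * transpose_mat W))"
      using W C T by (intro assoc_mult_mat) auto
    also have "C * (transpose_mat C * transpose_mat W) = C * transpose_mat C * transpose_mat W"
      by (rule assoc_mult_mat[symmetric, OF C T(2,1)])
    also have "W * \<dots> = W * (C * transpose_mat C) * transpose_mat W"
      using W C T by (intro assoc_mult_mat[symmetric]) auto
    finally show ?thesis by (simp add: transpose_mult[OF W C])
  qed
  also have "\<dots> = (W * transpose_mat W) ^\<^sub>m Suc (Suc l)"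
    unfolding CC by (rule gram_power[OF W])
  finally show ?case by (simp add: W_def C_def Let_def)
qed

lemma frob_sq_gram_right:
  "frob_sq W = (\<Sum>i<dim_row W. (W * transpose_mat W) $$ (i,i))"
  by (simp add: frob_sq_def scalar_prod_def power2_eq_square lessThan_atLeast0)

lemma frob_sq_gram_left:
  "frob_sq W = (\<Sum>i<dim_col W. (transpose_mat W * W) $$ (i,i))"
  unfolding frob_sq_def by (subst sum.swap) (simp add: scalar_prod_def power2_eq_square lessThan_atLeast0)

text \<open>Taking traces in the balancedness relations shows that all factors have the same
  Frobenius norm.\<close>

lemma balanced_objective:
  assumes ws: "well_shaped K n L d Ws H" and b: "balanced L Ws H" and "L \<ge> 1"
  shows "objective L Ws H = real (L + 1) * frob_sq (Ws L)"
proof -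
  have fr: "frob_sq (if l = 0 then H else Ws l) = frob_sq H" if "l \<le> L" for l
    using that
  proof (induction l)
    case (Suc l)
    define W where "W = (if l = 0 then H else Ws l)"
    have "transpose_mat (Ws (Suc l)) * Ws (Suc l) = W * transpose_mat W"
      using b[unfolded balanced_def, rule_format, of "Suc l"] Suc.prems by (simp add: W_def)
    moreover have "dim_col (Ws (Suc l)) = dim_row W"
    proof -
      have "Ws (Suc l) \<in> carrier_mat (if Suc l = L then K else d) d"
        using well_shapedD(2,3)[OF ws] Suc.prems by auto
      moreover have "W \<in> carrier_mat d (if l = 0 then n * K else d)"
        using well_shapedD(1,3)[OF ws] Suc.prems by (auto simp: W_def)
      ultimately show ?thesis by simp
    qed
    ultimately have "frob_sq (Ws (Suc l)) = frob_sq W"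
      by (simp only: frob_sq_gram_left[of "Ws (Suc l)"] frob_sq_gram_right[of W])
    then show ?case using Suc by (simp add: W_def)
  qed simp
  have "frob_sq (Ws l) = frob_sq H" if "1 \<le> l" "l \<le> L" for l using fr[OF that(2)] that by simp
  then show ?thesis using \<open>L \<ge> 1\<close> by (simp add: objective_def algebra_simps)
qed

lemma etf_logits_gram:
  assumes "n \<ge> 1" "r < K" "s < K"
  shows "(etf_logits K n * transpose_mat (etf_logits K n)) $$ (r,s) = n * ((if r = s then 1 else 0) - 1 / K)"
proof -
  have c: "etf_logits K n \<in> carrier_mat K (n * K)" by (simp add: etf_logits_def)
  have "(etf_logits K n * transpose_mat (etf_logits K n)) $$ (r,s)
      = (\<Sum>j<n * K. ((if r = j div n then 1 else 0) - 1 / K) * ((if s = j div n then 1 else 0) - 1 / K))"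
    using assms c by (subst index_mult_mat_sum[OF c, of _ K]) (auto simp: etf_logits_def intro!: sum.cong)
  also have "\<dots> = (\<Sum>c<K. \<Sum>i<n. ((if r = c then 1 else 0) - 1 / K) * ((if s = c then 1 else 0) - 1 / K))"
    unfolding sum_blocks by (intro sum.cong refl) (use \<open>n \<ge> 1\<close> in auto)
  also have "\<dots> = n * (\<Sum>c<K. ((if r = c then 1 else 0) - 1 / K) * ((if s = c then 1 else 0) - 1 / K))"
    by (simp add: sum_distrib_left)
  also have "(\<Sum>c<K. ((if r = c then 1 else 0) - 1 / K) * ((if s = c then 1 else 0) - 1 / real K))
      = (if r = s then 1 else 0) - 1 / K"
    using assms by (subst sum_delta_minus_prod) auto
  finally show ?thesis .
qed

text \<open>Here G^(L+1) = n S. Each diagonal entry of \<open>G\<close> is a first moment of a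
  vector fixed by \<open>S\<close>, so the moment bound applies with t^(L+1) = n; adding the K
  entries bounds the trace by (K - 1) t.\<close>

lemma DNC_objective_le:
  assumes "K \<ge> 2" "n \<ge> 1" "L \<ge> 1" and dnc: "DNC_point K n L d Ws H"
  shows "objective L Ws H \<le> real (L + 1) * real (K - 1) * root (L + 1) n"
proof -
  have ws: "well_shaped K n L d Ws H" and b: "balanced L Ws H" and Z: "logits L Ws H = etf_logits K n"
    using dnc by (auto simp: DNC_point_def)
  define W where "W = Ws L"
  define G where "G = W * transpose_mat W"
  define g where "g r s = G $$ (r,s)" for r s
  define t where "t = root (L + 1) n"
  have W: "W \<in> carrier_mat K d" using ws by (simp add: W_def well_shaped_def)
  have WT: "transpose_mat W \<in> carrier_mat d K" using W by simp
  have G: "G \<in> carrier_mat K K" using W by (simp add: G_def)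
  have t: "t > 0" "t ^ (L + 1) = n" using \<open>n \<ge> 1\<close> by (auto simp: t_def real_root_pow_pos2 simp del: power_Suc)
  have gW: "g r s = (\<Sum>k<d. W $$ (r,k) * W $$ (s,k))" if "r < K" "s < K" for r s
    unfolding g_def G_def index_mult_mat_sum[OF W WT that] using W that by (intro sum.cong) auto
  have sym: "g r s = g s r" if "r < K" "s < K" for r s
    using that by (simp add: gW mult.commute)
  have psd: "(\<Sum>r<K. x r * apply_kernel K g x r) \<ge> 0" for x
  proof -
    have "(\<Sum>r<K. x r * apply_kernel K g x r) = (\<Sum>r<K. \<Sum>s<K. \<Sum>k<d. (x r * W $$ (r,k)) * (x s * W $$ (s,k)))"
      by (intro sum.cong refl) (auto simp: apply_kernel_def sum_distrib_left gW sum_distrib_right mult_ac intro!: sum.cong)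
    also have "\<dots> = (\<Sum>k<d. \<Sum>r<K. \<Sum>s<K. (x r * W $$ (r,k)) * (x s * W $$ (s,k)))"
      by (subst (2) sum.swap, subst sum.swap, rule refl)
    also have "\<dots> = (\<Sum>k<d. (\<Sum>r<K. x r * W $$ (r,k))\<^sup>2)"
      by (simp add: power2_eq_square sum_product)
    finally show ?thesis by (simp add: sum_nonneg)
  qed
  have "G ^\<^sub>m (L + 1) = etf_logits K n * transpose_mat (etf_logits K n)"
    using balanced_chain_gram[OF ws b order_refl \<open>L \<ge> 1\<close>] \<open>L \<ge> 1\<close> Z
    by (simp add: logits_def G_def W_def Let_def)
  then have pow: "(apply_kernel K g ^^ (L + 1)) v r = n * (\<Sum>s<K. ((if r = s then 1 else 0) - 1 / K) * v s)"
    if "r < K" for r v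
    using that \<open>n \<ge> 1\<close> unfolding g_def funpow_apply_kernel[OF G that]
    by (simp add: etf_logits_gram sum_distrib_left mult.assoc del: index_mult_mat)
  \<comment> \<open>\<open>S\<close> annihilates the all-ones vector, hence so does a power of
    \<open>G\<close>, and hence \<open>G\<close> itself.\<close>
  have ker: "(\<Sum>s<K. g r s) = 0" if "r < K" for r
  proof -
    have "apply_kernel K g (\<lambda>_. 1) r = 0"
    proof (rule kernel_power_zero[OF sym _ _ that])
      show "(apply_kernel K g ^^ (L + 1)) (\<lambda>_. 1) r = 0" if "r < K" for r
        unfolding pow[OF that] sum_delta_minus[OF that] using that by simp
    qed auto
    then show ?thesis by (simp add: apply_kernel_def)
  qed
  \<comment> \<open>Column \<open>c\<close> of \<open>S\<close>: the unit vector projected off the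
    all-ones vector. It has squared norm 1 - 1/K, and since \<open>G\<close> kills the all-ones
    vector its first moment is the entry \<open>g c c\<close>.\<close>
  define v where "v c r = (if c = r then 1 else 0) - 1 / real K" for c r :: nat
  have vsum: "(\<Sum>r<K. v c r) = 0" if "c < K" for c using that by (simp add: v_def sum_subtractf)
  have Av: "apply_kernel K g (v c) r = g r c" if "r < K" "c < K" for r c
    using sum_delta_minus[OF that(2), of "1 / K" "g r"] ker[OF that(1)]
    by (simp add: apply_kernel_def v_def mult.commute)
  have diag: "(\<Sum>r<K. v c r * apply_kernel K g (v c) r) = g c c" if "c < K" for c
  proof -
    have "(\<Sum>r<K. v c r * apply_kernel K g (v c) r) = (\<Sum>r<K. v c r * g c r)"
      by (intro sum.cong refl) (use that Av sym in auto)
    also have "\<dots> = g c c" unfolding v_def sum_delta_minus[OF that] ker[OF that] by simp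
    finally show ?thesis .
  qed
  have le: "g c c \<le> t * (1 - 1 / K)" if "c < K" for c
  proof -
    have "g c c \<le> t * (\<Sum>r<K. (v c r)\<^sup>2)"
      unfolding diag[OF that, symmetric]
    proof (rule moment_first_le[OF sym psd t(1), where N = "L + 1"])
      fix r assume r: "r < K"
      have "(\<Sum>s<K. ((if r = s then 1 else 0) - 1 / K) * v c s) = v c r"
        unfolding sum_delta_minus[OF r] vsum[OF that] by simp
      then show "(apply_kernel K g ^^ (L + 1)) (v c) r = t ^ (L + 1) * v c r"
        unfolding pow[OF r] t(2) by simp
    qed auto
    also have "(\<Sum>r<K. (v c r)\<^sup>2) = 1 - 1 / K"
      unfolding v_def power2_eq_square using that by (subst sum_delta_minus_prod) auto
    finally show ?thesis .
  qed
  have "frob_sq W = (\<Sum>c<K. g c c)" using W by (simp only: frob_sq_gram_right carrier_matD g_def G_def)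
  also have "\<dots> \<le> (\<Sum>c<K. t * (1 - 1 / K))" by (intro sum_mono) (use le in auto)
  also have "\<dots> = real (K - 1) * t" using \<open>K \<ge> 2\<close> by (simp add: of_nat_diff field_simps)
  finally have "real (L + 1) * frob_sq W \<le> real (L + 1) * (real (K - 1) * t)"
    by (rule mult_left_mono) simp
  also have "real (L + 1) * frob_sq W = objective L Ws H"
    by (simp only: balanced_objective[OF ws b \<open>L \<ge> 1\<close>] W_def)
  finally show ?thesis by (simp only: t_def mult.assoc)
qed

section \<open>The cross-polytope competitor\<close>

text \<open>Classes \<open>2a\<close> and \<open>2a + 1\<close> are paired (for odd \<open>K\<close> the last class stays alone). Class \<open>c\<close> has logit
  \<open>1\<close> on itself, \<open>-1\<close> on its partner and \<open>0\<close> elsewhere, so the pair \<open>a\<close> contributes the singular value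
  \<open>pair_size K a * sqrt n\<close> with left singular vector \<open>pair_vec K a\<close>.\<close>

definition pair_size :: "nat \<Rightarrow> nat \<Rightarrow> real" where
  "pair_size K a = (if 2 * a + 1 < K then 2 else 1)"

definition pair_vec :: "nat \<Rightarrow> nat \<Rightarrow> nat \<Rightarrow> real" where
  "pair_vec K a c = (if c div 2 = a then (-1) ^ c / sqrt (pair_size K a) else 0)"

text \<open>The singular value of the pair is shared equally among the L + 1 factors, as
  balancedness would demand.\<close>

definition pair_scale :: "nat \<Rightarrow> nat \<Rightarrow> nat \<Rightarrow> nat \<Rightarrow> real" where
  "pair_scale K n L a = root (L + 1) (pair_size K a * sqrt n)"

text \<open>Hidden coordinate \<open>a\<close> carries pair \<open>a\<close>; the coordinates with
  2a \<ge> K correspond to no class and carry 0.\<close>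

definition cross_layers :: "nat \<Rightarrow> nat \<Rightarrow> nat \<Rightarrow> nat \<Rightarrow> nat \<Rightarrow> real mat" where
  "cross_layers K n L d l = (if l = L then mat K d (\<lambda>(c,a). pair_scale K n L a * pair_vec K a c)
     else mat d d (\<lambda>(a,b). if a = b \<and> 2 * a < K then pair_scale K n L a else 0))"

definition cross_features :: "nat \<Rightarrow> nat \<Rightarrow> nat \<Rightarrow> nat \<Rightarrow> real mat" where
  "cross_features K n L d = mat d (n * K) (\<lambda>(a,j). pair_scale K n L a * pair_vec K a (j div n) / sqrt n)"

lemma pair_size_pos: "pair_size K a > 0"
  by (simp add: pair_size_def)

lemma cross_well_shaped: "well_shaped K n L d (cross_layers K n L d) (cross_features K n L d)"
  by (auto simp: well_shaped_def cross_layers_def cross_features_def)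

lemma pair_vec_eq_0:
  assumes "K \<le> 2 * a" "c < K" shows "pair_vec K a c = 0"
  using assms by (auto simp: pair_vec_def)

lemma cross_chain:
  assumes "l < L" "a < d" "j < n * K"
  shows "chain (cross_layers K n L d) (cross_features K n L d) l $$ (a,j)
    = pair_scale K n L a ^ (l + 1) * pair_vec K a (j div n) / sqrt n"
  using \<open>l < L\<close>
proof (induction l)
  case 0
  then show ?case using assms by (simp add: cross_features_def)
next
  case (Suc l)
  let ?W = "cross_layers K n L d" and ?H = "cross_features K n L d"
  have jK: "j div n < K" using \<open>j < n * K\<close> by (simp add: less_mult_imp_div_less mult.commute)
  have W: "?W (Suc l) \<in> carrier_mat d d" using Suc.prems by (simp add: cross_layers_def)
  have C: "chain ?W ?H l \<in> carrier_mat d (n * K)"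
    using well_shapedD(4)[OF cross_well_shaped] Suc.prems by simp
  have "chain ?W ?H (Suc l) $$ (a,j) = (\<Sum>b<d. ?W (Suc l) $$ (a,b) * chain ?W ?H l $$ (b,j))"
    using index_mult_mat_sum[OF W C assms(2,3)] by simp
  also have "\<dots> = (\<Sum>b<d. if b = a then (if 2 * a < K then pair_scale K n L a else 0) * chain ?W ?H l $$ (b,j) else 0)"
    by (intro sum.cong refl) (use Suc.prems \<open>a < d\<close> in \<open>auto simp: cross_layers_def\<close>)
  also have "\<dots> = (if 2 * a < K then pair_scale K n L a else 0) * chain ?W ?H l $$ (a,j)"
    using \<open>a < d\<close> by simp
  finally show ?case using Suc pair_vec_eq_0[OF _ jK, of a] by auto
qed

lemma pair_scale_power: "pair_scale K n L a ^ (L + 1) = pair_size K a * sqrt n"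
  unfolding pair_scale_def using pair_size_pos[of K a] by (intro real_root_pow_pos2) auto

text \<open>The L + 1 scales multiply to \<open>pair_size K a * sqrt n\<close>, which cancels the
  normalisations of the two pair vectors and of the features and leaves only signs.\<close>

lemma cross_logits:
  assumes "L \<ge> 1" "n \<ge> 1" "d \<ge> K" "c < K" "j < n * K"
  shows "logits L (cross_layers K n L d) (cross_features K n L d) $$ (c,j)
    = (if (j div n) div 2 = c div 2 then (-1) ^ (c + j div n) else 0)"
proof -
  let ?W = "cross_layers K n L d" and ?H = "cross_features K n L d"
  let ?a = "c div 2"
  have a: "?a < d" using assms by simp
  have W: "?W L \<in> carrier_mat K d" by (simp add: cross_layers_def)
  have C: "chain ?W ?H (L - 1) \<in> carrier_mat d (n * K)"
    using well_shapedD(4)[OF cross_well_shaped] assms(1) by simp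
  have "logits L ?W ?H $$ (c,j) = (\<Sum>b<d. ?W L $$ (c,b) * chain ?W ?H (L - 1) $$ (b,j))"
    unfolding logits_Suc[OF assms(1)] by (rule index_mult_mat_sum[OF W C assms(4,5)])
  also have "\<dots> = (\<Sum>b<d. if b = ?a then pair_scale K n L b * pair_vec K b c *
      (pair_scale K n L b ^ L * pair_vec K b (j div n) / sqrt n) else 0)"
    by (intro sum.cong refl)
      (use assms cross_chain[of "L - 1" L _ d j n K] in \<open>auto simp: cross_layers_def pair_vec_def\<close>)
  also have "\<dots> = pair_scale K n L ?a ^ (L + 1) * (pair_vec K ?a c * pair_vec K ?a (j div n)) / sqrt n"
    using a by simp
  also have "\<dots> = pair_size K ?a * (pair_vec K ?a c * pair_vec K ?a (j div n))"
    unfolding pair_scale_power using \<open>n \<ge> 1\<close> by simp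
  also have "\<dots> = (if (j div n) div 2 = c div 2 then (-1) ^ (c + j div n) else 0)"
    using pair_size_pos[of K ?a] by (simp add: pair_vec_def power_add)
  finally show ?thesis .
qed

lemma cross_feasible:
  assumes "L \<ge> 1" "n \<ge> 1" "d \<ge> K"
  shows "feasible K n L (cross_layers K n L d) (cross_features K n L d)"
  unfolding feasible_def
proof (intro allI impI)
  fix c c' i assume h: "c < K" "c' < K" "i < n" "c' \<noteq> c"
  have j: "c * n + i < n * K" "(c * n + i) div n = c" using h block_index_less by auto
  \<comment> \<open>Partners have opposite parity, so the logit of the partner is -1 and the margin
    is 2; against any other class it is 1.\<close>
  have odd: "odd (c' + c)" if "c div 2 = c' div 2" using that h(4) by presburger
  show "1 \<le> logits L (cross_layers K n L d) (cross_features K n L d) $$ (c, c * n + i)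
     - logits L (cross_layers K n L d) (cross_features K n L d) $$ (c', c * n + i)"
    using cross_logits[OF assms h(1) j(1)] cross_logits[OF assms h(2) j(1)] odd
    by (auto simp: j(2))
qed

lemma pair_scale_sq: "(pair_scale K n L a)\<^sup>2 = root (L + 1) ((pair_size K a)\<^sup>2) * root (L + 1) n"
proof -
  have "(pair_scale K n L a)\<^sup>2 = root (L + 1) ((pair_size K a * sqrt n)\<^sup>2)"
    unfolding pair_scale_def by (simp add: real_root_power)
  then show ?thesis by (simp add: power_mult_distrib real_root_mult)
qed

lemma pair_vec_sq: "(pair_vec K a c)\<^sup>2 = (if a = c div 2 then 1 / pair_size K a else 0)"
  using pair_size_pos[of K a] by (auto simp: pair_vec_def power_divide less_imp_le power_mult[symmetric] mult.commute)

text \<open>Every factor has squared Frobenius norm \<open>B\<close>, the sum of the squared scales.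
  A full pair contributes root 4 times root n (roots of order L + 1), and a lone last class
  contributes root n.\<close>

lemma cross_objective:
  assumes "L \<ge> 1" "n \<ge> 1" "d \<ge> K"
  shows "objective L (cross_layers K n L d) (cross_features K n L d)
    = real (L + 1) * ((real (K div 2) * root (L + 1) 4 + real (K mod 2)) * root (L + 1) n)"
proof -
  define s where "s a = (pair_scale K n L a)\<^sup>2" for a
  define m where "m = K div 2"
  define b where "b = K mod 2"
  define B where "B = (real m * root (L + 1) 4 + real (b)) * root (L + 1) n"
  have K: "K = 2 * m + b" and b: "b = 0 \<or> b = 1" by (auto simp: m_def b_def)
  have s_pair: "s a = root (L + 1) 4 * root (L + 1) n" "pair_size K a = 2" if "a < m" for a
    using that K by (auto simp: s_def pair_scale_sq pair_size_def)
  have s_single: "s m = root (L + 1) n" "pair_size K m = 1"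
    using K b by (auto simp: s_def pair_scale_sq pair_size_def)
  have sumW: "(\<Sum>c<K. s (c div 2) / pair_size K (c div 2)) = B"
  proof -
    have un: "{..<K} = {..<2 * m} \<union> {2 * m..<2 * m + b}" using K by auto
    have "(\<Sum>c<K. s (c div 2) / pair_size K (c div 2)) =
      (\<Sum>c<2 * m. s (c div 2) / pair_size K (c div 2)) + (\<Sum>c=2*m..<2*m + b. s (c div 2) / pair_size K (c div 2))"
      unfolding un by (rule sum.union_disjoint) auto
    also have "(\<Sum>c<2 * m. s (c div 2) / pair_size K (c div 2)) = (\<Sum>c<2 * m. root (L + 1) 4 * root (L + 1) n / 2)"
      by (intro sum.cong refl) (auto simp: s_pair)
    also have "(\<Sum>c=2*m..<2*m + b. s (c div 2) / pair_size K (c div 2)) = (\<Sum>c=2*m..<2*m + b. root (L + 1) n)"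
    proof (intro sum.cong refl)
      fix c assume "c \<in> {2*m..<2*m + b}"
      then have "c div 2 = m" using b by auto
      then show "s (c div 2) / pair_size K (c div 2) = root (L + 1) n" by (simp add: s_single)
    qed
    finally show ?thesis by (simp add: B_def algebra_simps)
  qed
  have fW: "frob_sq (cross_layers K n L d L) = B"
  proof -
    have "frob_sq (cross_layers K n L d L) = (\<Sum>c<K. \<Sum>a<d. if a = c div 2 then s a / pair_size K a else 0)"
      unfolding frob_sq_def
      by (simp add: cross_layers_def power_mult_distrib pair_vec_sq s_def if_distrib cong: if_cong)
    also have "\<dots> = (\<Sum>c<K. s (c div 2) / pair_size K (c div 2))"
      by (intro sum.cong refl) (use \<open>d \<ge> K\<close> in auto)
    finally show ?thesis by (simp add: sumW)
  qed
  have fH: "frob_sq (cross_features K n L d) = B"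
  proof -
    have "frob_sq (cross_features K n L d) =
        (\<Sum>a<d. \<Sum>j<n * K. if a = (j div n) div 2 then s a / pair_size K a / n else 0)"
      unfolding frob_sq_def
      by (auto simp: cross_features_def power_mult_distrib power_divide pair_vec_sq s_def intro!: sum.cong)
    also have "\<dots> = (\<Sum>j<n * K. s ((j div n) div 2) / pair_size K ((j div n) div 2) / n)"
    proof (subst sum.swap, intro sum.cong refl)
      fix j assume "j \<in> {..<n * K}"
      then have "j div n < K" by (simp add: less_mult_imp_div_less mult.commute)
      then have "(j div n) div 2 < d" using \<open>d \<ge> K\<close> by simp
      then show "(\<Sum>a<d. if a = (j div n) div 2 then s a / pair_size K a / n else 0)
         = s ((j div n) div 2) / pair_size K ((j div n) div 2) / n" by simp
    qed
    also have "\<dots> = (\<Sum>c<K. \<Sum>i<n. s (c div 2) / pair_size K (c div 2) / n)"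
      unfolding sum_blocks by (intro sum.cong refl) (use \<open>n \<ge> 1\<close> in auto)
    also have "\<dots> = (\<Sum>c<K. s (c div 2) / pair_size K (c div 2))" using \<open>n \<ge> 1\<close> by simp
    finally show ?thesis by (simp add: sumW)
  qed
  have fD: "frob_sq (cross_layers K n L d l) = B" if "l \<noteq> L" for l
  proof -
    have "frob_sq (cross_layers K n L d l) = (\<Sum>a<d. \<Sum>b<d. (cross_layers K n L d l $$ (a,b))\<^sup>2)"
      using that by (simp add: frob_sq_def cross_layers_def)
    also have "\<dots> = (\<Sum>a<d. \<Sum>b<d. if b = a then (if 2 * a < K then s a else 0) else 0)"
      by (intro sum.cong refl) (use that in \<open>auto simp: cross_layers_def s_def\<close>)
    also have "\<dots> = (\<Sum>a<d. if 2 * a < K then s a else 0)" by simp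
    \<comment> \<open>There are m + b occupied coordinates: the m full pairs and, for odd K, the
      lone class.\<close>
    also have "\<dots> = (\<Sum>a<m + b. if 2 * a < K then s a else 0)"
      by (rule sum.mono_neutral_right) (use K \<open>d \<ge> K\<close> in auto)
    also have "\<dots> = (\<Sum>a<m. s a) + (if b = 1 then s m else 0)"
    proof -
      have "(\<Sum>a<m. if 2 * a < K then s a else 0) = (\<Sum>a<m. s a)"
        using K by (intro sum.cong) auto
      moreover have "2 * m < K" if "b = 1" using K that by linarith
      ultimately show ?thesis using b by auto
    qed
    also have "\<dots> = B"
      using b by (auto simp: B_def s_pair s_single algebra_simps)
    finally show ?thesis .
  qed
  have "frob_sq (cross_layers K n L d l) = B" for l using fW fD by (cases "l = L") auto
  then show ?thesis by (simp add: objective_def fH B_def m_def b_def algebra_simps)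
qed

text \<open>With m = K div 2 the parity term cancels and the claim becomes 4^(1/(L+1)) < 2 - 1/m.
  For L = 2 and m \<ge> 3 the value 5/3 separates the sides, as (5/3)^3 = 125/27 > 4; for L \<ge> 3
  and m \<ge> 2 the value 3/2 does, as (3/2)^4 = 81/16 > 4.\<close>

lemma cross_value_less:
  assumes "(L = 2 \<and> K \<ge> 6) \<or> (L \<ge> 3 \<and> K \<ge> 4)"
  shows "real (K div 2) * root (L + 1) 4 + real (K mod 2) < real (K - 1)"
proof -
  define m where "m = K div 2"
  have K: "real (K - 1) = 2 * real m + real (K mod 2) - 1"
  proof -
    have "K = 2 * m + K mod 2" by (simp add: m_def)
    moreover have "K \<ge> 1" using assms by auto
    ultimately have "real K = 2 * real m + real (K mod 2)" by linarith
    then show ?thesis using \<open>K \<ge> 1\<close> by (simp add: of_nat_diff)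
  qed
  have root_less: "root (L + 1) 4 < x" if "4 < x ^ (L + 1)" "x > 0" for x :: real
  proof -
    have "root (L + 1) 4 < root (L + 1) (x ^ (L + 1))" using that by (subst real_root_less_iff) auto
    then show ?thesis using that by (simp add: real_root_power_cancel del: power_Suc)
  qed
  from assms show ?thesis
  proof
    assume h: "L = 2 \<and> K \<ge> 6"
    then have "m \<ge> 3" unfolding m_def by presburger
    then have m: "real m \<ge> 3" by simp
    have "root (L + 1) 4 < 5 / 3" using h by (intro root_less) (auto simp: power_numeral_reduce)
    then have "real m * root (L + 1) 4 < real m * (5 / 3)" using m by simp
    then show ?thesis using m unfolding K m_def[symmetric] by linarith
  next
    assume h: "L \<ge> 3 \<and> K \<ge> 4"
    then have "m \<ge> 2" unfolding m_def by presburger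
    then have m: "real m \<ge> 2" by simp
    have "(4::real) < (3 / 2) ^ 4" by (simp add: power_numeral_reduce)
    also have "\<dots> \<le> (3 / 2) ^ (L + 1)" using h by (intro power_increasing) auto
    finally have "root (L + 1) 4 < 3 / 2" by (intro root_less) auto
    then have "real m * root (L + 1) 4 < real m * (3 / 2)" using m by simp
    then show ?thesis using m unfolding K m_def[symmetric] by linarith
  qed
qed

section \<open>Local but not global minimality\<close>

text \<open>A DNC point has zero slack, so the local lower bound holds at the point itself and meets
  the upper bound.\<close>

lemma DNC_objective:
  assumes "K \<ge> 2" "n \<ge> 1" "L \<ge> 1" "d \<ge> K" and dnc: "DNC_point K n L d Ws H"
  shows "objective L Ws H = real (L + 1) * real (K - 1) * root (L + 1) n"
proof (rule antisym[OF DNC_objective_le[OF assms(1-3) dnc] objective_ge_of_small_slack[OF assms(1-4)]])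
  show "well_shaped K n L d Ws H" using dnc by (simp add: DNC_point_def)
  have Z: "logits L Ws H = etf_logits K n" using dnc by (simp add: DNC_point_def)
  show "slack n (logits L Ws H) r c \<ge> 0" if "r < K" "c < K" for r c
    using that \<open>n \<ge> 1\<close> by (simp add: Z slack_etf_logits)
  show "(\<Sum>r<K. \<Sum>c<K. slack n (logits L Ws H) r c) \<le> 1 / (real K * (4 ^ (K - 1) + fact (K - 1) * 2 ^ (K - 1)))"
    using \<open>n \<ge> 1\<close> by (simp add: Z slack_etf_logits)
qed

theorem theorem3p1:
  fixes K n L d :: nat and Ws :: "nat \<Rightarrow> real mat" and H :: "real mat"
  assumes "K \<ge> 2" and "n \<ge> 1" and "L \<ge> 1" and "d \<ge> K"
    and "DNC_point K n L d Ws H"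
    and "(L = 2 \<and> K \<ge> 6) \<or> (L \<ge> 3 \<and> K \<ge> 4)"
  shows "(\<exists>Ws' H'. well_shaped K n L d Ws' H' \<and> feasible K n L Ws' H' \<and>
            objective L Ws' H' < objective L Ws H)
       \<and> (\<exists>\<epsilon>>0. \<forall>Ws' H'. well_shaped K n L d Ws' H' \<and> feasible K n L Ws' H' \<and>
            param_dist_sq L Ws H Ws' H' < \<epsilon> \<longrightarrow> objective L Ws' H' \<ge> objective L Ws H)"
proof
  note obj = DNC_objective[OF assms(1-5)]
  have "(real (K div 2) * root (L + 1) 4 + real (K mod 2)) * root (L + 1) n < real (K - 1) * root (L + 1) n"
    using cross_value_less[OF assms(6)] \<open>n \<ge> 1\<close> by (intro mult_strict_right_mono) auto
  then have "real (L + 1) * ((real (K div 2) * root (L + 1) 4 + real (K mod 2)) * root (L + 1) n)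
      < real (L + 1) * (real (K - 1) * root (L + 1) n)"
    by (intro mult_strict_left_mono) auto
  then have "objective L (cross_layers K n L d) (cross_features K n L d) < objective L Ws H"
    unfolding cross_objective[OF assms(3,2,4)] obj by (simp only: mult.assoc)
  then show "\<exists>Ws' H'. well_shaped K n L d Ws' H' \<and> feasible K n L Ws' H' \<and>
            objective L Ws' H' < objective L Ws H"
    using cross_well_shaped cross_feasible[OF assms(3,2,4)] by blast
  \<comment> \<open>The total slack up to which the determinantal lower bound is valid; continuity
    then supplies the radius.\<close>
  define e where "e = 1 / (real K * (4 ^ (K - 1) + fact (K - 1) * 2 ^ (K - 1)))"
  have "e > 0" unfolding e_def using \<open>K \<ge> 2\<close> by (intro divide_pos_pos mult_pos_pos add_pos_pos) auto
  then obtain \<epsilon> where "\<epsilon> > 0" and near: "\<And>Ws' H'. well_shaped K n L d Ws' H' \<Longrightarrow>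
      param_dist_sq L Ws H Ws' H' < \<epsilon> \<Longrightarrow> (\<Sum>r<K. \<Sum>c<K. slack n (logits L Ws' H') r c) \<le> e"
    using slack_small_nearby[OF assms(2,3), of K d Ws H e] assms(5) unfolding DNC_point_def by blast
  have "objective L Ws' H' \<ge> objective L Ws H"
    if ws: "well_shaped K n L d Ws' H'" and f: "feasible K n L Ws' H'"
      and dist: "param_dist_sq L Ws H Ws' H' < \<epsilon>" for Ws' H'
    unfolding obj
    by (rule objective_ge_of_small_slack[OF assms(1-4) ws slack_nonneg[OF f \<open>n \<ge> 1\<close>]
          near[OF ws dist, unfolded e_def]])
  then show "\<exists>\<epsilon>>0. \<forall>Ws' H'. well_shaped K n L d Ws' H' \<and> feasible K n L Ws' H' \<and>
            param_dist_sq L Ws H Ws' H' < \<epsilon> \<longrightarrow> objective L Ws' H' \<ge> objective L Ws H"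
    using \<open>\<epsilon> > 0\<close> by blast
qed

end
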